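(* Let $p,b,f\in C^\infty[0,1]$ and $u_L,u_R\in\mathbb{R}$ be fixed (independent of $\varepsilon$), with $p(0)=0$, $p'(0)>0$, $|p'(x)|\ge\frac12|p'(0)|$ on $[0,1]$, and $b(x)\ge b_0>0$ on $[0,1]$. For $0<\varepsilon\le1$ let $u$ be the solution of $$-\varepsilon u''+p(x)u'+b(x)u=f(x),\quad 0<x<1,\qquad u(0)=u_L,\ u(1)=u_R .$$ Let $\rho=C_0\sqrt{\varepsilon}$, where $C_0>0$ is the $\varepsilon$-independent constant described in the context. Then for every $k=1,2,\ldots$ there is a constant $C$ independent of $\varepsilon$ and $x$ such that, for $0\le x\le 1/2$, $$|u^{(k)}(x)|\le\begin{cases}C(1+\rho^{-k}), & 0\le x\le\rho,\\ C(1+x^{-k}), & \rho\le x\le 1/2,\end{cases}$$ or, in compact form, $|u^{(k)}(x)|\le C\bigl(1+(\max\{x,\rho\})^{-k}\bigr)$ for $0\le x\le1/2$.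
   Context: The constant $C_0$: let $U(a,x),V(a,x)$ be Weber's parabolic cylinder functions, the standard linearly independent solutions of $-y''+(a+x^2/4)y=0$. $C_0=O(1)$ is a positive constant depending only on the parameter(s) $a$ such that for $x\ge C_0$, $$U(a,x)=e^{-x^2/4}x^{-a-1/2}\delta_1,\qquad V(a,x)=\sqrt{2/\pi}\,e^{x^2/4}x^{a-1/2}\delta_2,\qquad |\delta_i-1|\le\tfrac13\ (i=1,2).$$ Here the relevant parameters are $a=\beta-\frac12+j$, $0\le j\le k$, with $\beta=b(0)/p'(0)$. In particular $C_0$ does not depend on $\varepsilon$. *)

theory Defs
  imports "HOL-Analysis.Analysis"
begin

text \<open>
  Derivatives are taken within \<open>S\<close>, so that at an end point of an interval they are
  one-sided and values of the function outside \<open>S\<close> are irrelevant.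
\<close>
primrec nth_deriv_within :: "real set \<Rightarrow> nat \<Rightarrow> (real \<Rightarrow> real) \<Rightarrow> real \<Rightarrow> real" where
  "nth_deriv_within S 0 g = g"
| "nth_deriv_within S (Suc n) g = (\<lambda>x. vector_derivative (nth_deriv_within S n g) (at x within S))"

definition smooth_within :: "real set \<Rightarrow> (real \<Rightarrow> real) \<Rightarrow> bool" where
  "smooth_within S g \<longleftrightarrow> (\<forall>n. \<forall>x\<in>S. nth_deriv_within S n g differentiable (at x within S))"

definition kummer_M :: "real \<Rightarrow> real \<Rightarrow> real \<Rightarrow> real" where
  "kummer_M a c z = (\<Sum>n. pochhammer a n / (pochhammer c n * fact n) * z ^ n)"

text \<open>
  The even and odd solutions of \<open>y'' = (a + x\<^sup>2 / 4) y\<close> with \<open>y(0) = 1, y'(0) = 0\<close> and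
  \<open>y(0) = 0, y'(0) = 1\<close> respectively (Abramowitz and Stegun, 19.2.1 and 19.2.3).
\<close>
definition weber_even :: "real \<Rightarrow> real \<Rightarrow> real" where
  "weber_even a x = exp (- (x\<^sup>2 / 4)) * kummer_M (a / 2 + 1 / 4) (1 / 2) (x\<^sup>2 / 2)"

definition weber_odd :: "real \<Rightarrow> real \<Rightarrow> real" where
  "weber_odd a x = x * exp (- (x\<^sup>2 / 4)) * kummer_M (a / 2 + 3 / 4) (3 / 2) (x\<^sup>2 / 2)"

text \<open>
  The coefficients are the standard values of \<open>U\<close>, \<open>U'\<close>, \<open>V\<close>, \<open>V'\<close> at \<open>x = 0\<close>
  (DLMF 12.2.6 to 12.2.9). The reciprocal Gamma function is entire, so they are
  correct for every real \<open>a\<close>, including the poles of the Gamma function.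
\<close>
definition weber_U :: "real \<Rightarrow> real \<Rightarrow> real" where
  "weber_U a x =
     sqrt pi * 2 powr (- a / 2 - 1 / 4) * rGamma (3 / 4 + a / 2) * weber_even a x
   - sqrt pi * 2 powr (- a / 2 + 1 / 4) * rGamma (1 / 4 + a / 2) * weber_odd a x"

definition weber_V :: "real \<Rightarrow> real \<Rightarrow> real" where
  "weber_V a x =
     pi * 2 powr (a / 2 + 1 / 4) * (rGamma (3 / 4 - a / 2))\<^sup>2 * rGamma (1 / 4 + a / 2) * weber_even a x
   + pi * 2 powr (a / 2 + 3 / 4) * (rGamma (1 / 4 - a / 2))\<^sup>2 * rGamma (3 / 4 + a / 2) * weber_odd a x"

definition weber_asymptotics_from :: "real \<Rightarrow> real \<Rightarrow> bool" where
  "weber_asymptotics_from a C0 \<longleftrightarrow>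
     (\<forall>x\<ge>C0. \<exists>\<delta>1 \<delta>2.
        weber_U a x = exp (- (x\<^sup>2 / 4)) * x powr (- a - 1 / 2) * \<delta>1 \<and>
        weber_V a x = sqrt (2 / pi) * exp (x\<^sup>2 / 4) * x powr (a - 1 / 2) * \<delta>2 \<and>
        \<bar>\<delta>1 - 1\<bar> \<le> 1 / 3 \<and> \<bar>\<delta>2 - 1\<bar> \<le> 1 / 3)"

text \<open>
  Classical solutions: continuous on \<open>[0,1]\<close> and twice differentiable on \<open>(0,1)\<close>;
  regularity up to the boundary is not part of the notion.
\<close>
definition bvp_solution ::
  "real \<Rightarrow> (real \<Rightarrow> real) \<Rightarrow> (real \<Rightarrow> real) \<Rightarrow> (real \<Rightarrow> real) \<Rightarrow> real \<Rightarrow> real \<Rightarrow> (real \<Rightarrow> real) \<Rightarrow> bool" where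
  "bvp_solution \<epsilon> p b f u_L u_R u \<longleftrightarrow>
     continuous_on {0..1} u \<and> u 0 = u_L \<and> u 1 = u_R \<and>
     (\<forall>x\<in>{0<..<1}. u differentiable (at x) \<and> deriv u differentiable (at x) \<and>
        - \<epsilon> * deriv (deriv u) x + p x * deriv u x + b x * u x = f x)"

end

theory Submission
  imports Defs
begin

text \<open>
  Each derivative \<open>w = u\<^sup>(\<^sup>k\<^sup>)\<close> satisfies \<open>- \<epsilon> w'' + p w' + (b + k p') w = F\<close>, where \<open>F\<close> involves only
  derivatives of \<open>u\<close> of order less than \<open>k\<close>. This operator obeys a maximum principle and has the
  supersolution \<open>(p + A sqrt \<epsilon>)\<^sup>-\<^sup>k + \<epsilon>\<^sup>-\<^sup>k exp (- c (1 - x\<^sup>2) / \<epsilon>)\<close>, whose second summand is bounded on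
  \<open>[0,1/2]\<close>. By induction on \<open>k\<close> only the boundary values remain to be estimated: they are
  \<open>O(\<epsilon>\<^sup>-\<^sup>k\<^sup>/\<^sup>2)\<close> at \<open>0\<close> and \<open>O(\<epsilon>\<^sup>-\<^sup>k)\<close> at \<open>1\<close>, by rescaling to unit length near each end point.
\<close>

text \<open>For x > 0 the function p^-k is annihilated by w -> p w' + k p' w, so only the part b >=
  \<open>b\<^sub>0\<close> of the zeroth order coefficient is left to pay for diffusion. The term
  \<epsilon> (p^-k)'' contains k (k+1) \<epsilon> p'^2 p^(-k-2), which is affordable only where p is
  at least a large multiple of sqrt \<epsilon>. This dictates the shift by a multiple of sqrt
  \<epsilon> and the size of \<open>A\<close>. At x = 1 the transport points out of the interval and
  a layer of width \<epsilon> can form. The barrier has to dominate it, but a crude bound there is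
  enough, because on [0,1/2] the exponential is smaller than every power of \<epsilon>. All
  constants have to be chosen before \<epsilon> and u, hence the existential form of the estimates.
  A classical solution is merely continuous at the end points, so derivatives there make sense only
  after regularity up to the boundary has been shown.\<close>

section \<open>Iterated one-sided derivatives and the Leibniz rule\<close>

lemma smooth_within_has_derivative:
  assumes "smooth_within S g" "x \<in> S"
  shows "(nth_deriv_within S n g has_real_derivative nth_deriv_within S (Suc n) g x) (at x within S)"
  using assms by (simp add: smooth_within_def has_real_derivative_iff_has_vector_derivative
      vector_derivative_works[symmetric])

lemma nth_deriv_within_Suc_eq:
  assumes "(nth_deriv_within {l..r} n g has_real_derivative d) (at x within {l..r})"
    and "l < r" "x \<in> {l..r}"
  shows "nth_deriv_within {l..r} (Suc n) g x = d"
  using vector_derivative_within_cbox[of l r x "nth_deriv_within {l..r} n g" d] assms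
  by (simp add: has_real_derivative_iff_has_vector_derivative)

lemma smooth_within_bounded:
  assumes "smooth_within {l..r} g"
  shows "\<exists>M\<ge>0. \<forall>i\<le>N. \<forall>x\<in>{l..r}. \<bar>nth_deriv_within {l..r} i g x\<bar> \<le> M"
proof -
  have "\<exists>m. \<forall>x\<in>{l..r}. \<bar>nth_deriv_within {l..r} i g x\<bar> \<le> m" for i
  proof -
    have "continuous_on {l..r} (nth_deriv_within {l..r} i g)"
      using smooth_within_has_derivative[OF assms] by (rule DERIV_continuous_on)
    then have "bounded (nth_deriv_within {l..r} i g ` {l..r})"
      by (intro compact_imp_bounded compact_continuous_image) auto
    then show ?thesis
      by (auto simp: bounded_iff)
  qed
  then obtain m where m: "\<And>i x. x \<in> {l..r} \<Longrightarrow> \<bar>nth_deriv_within {l..r} i g x\<bar> \<le> m i"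
    by metis
  show ?thesis
  proof (intro exI[of _ "\<Sum>i\<le>N. \<bar>m i\<bar>"] conjI allI impI ballI)
    fix i x assume "i \<le> N" "x \<in> {l..r}"
    then have "\<bar>nth_deriv_within {l..r} i g x\<bar> \<le> \<bar>m i\<bar>"
      using m[of x i] by linarith
    also have "\<dots> \<le> (\<Sum>i\<le>N. \<bar>m i\<bar>)"
      using \<open>i \<le> N\<close> by (intro member_le_sum) auto
    finally show "\<bar>nth_deriv_within {l..r} i g x\<bar> \<le> (\<Sum>i\<le>N. \<bar>m i\<bar>)" .
  qed (simp add: sum_nonneg)
qed

text \<open>Pascal's rule merges the two sums. The factors are abstract sequences, each member
  having the next as derivative, so that the shifted family \<open>D (Suc j) u\<close> can be
  inserted as well.\<close>

lemma has_real_derivative_Leibniz: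
  fixes G H :: "nat \<Rightarrow> real \<Rightarrow> real"
  assumes G: "\<And>i. i \<le> n \<Longrightarrow> (G i has_real_derivative G (Suc i) x) (at x within S)"
    and H: "\<And>i. i \<le> n \<Longrightarrow> (H i has_real_derivative H (Suc i) x) (at x within S)"
  shows "((\<lambda>x. \<Sum>j\<le>n. real (n choose j) * (G (n - j) x * H j x)) has_real_derivative
    (\<Sum>j\<le>Suc n. real (Suc n choose j) * (G (Suc n - j) x * H j x))) (at x within S)"
proof -
  have "((\<lambda>x. \<Sum>j\<le>n. real (n choose j) * (G (n - j) x * H j x)) has_real_derivative
    (\<Sum>j\<le>n. real (n choose j) * (G (Suc (n - j)) x * H j x + H (Suc j) x * G (n - j) x)))
    (at x within S)"
    by (intro DERIV_sum DERIV_cmult DERIV_mult G H) auto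
  moreover have "(\<Sum>j\<le>n. real (n choose j) * (G (Suc (n - j)) x * H j x + H (Suc j) x * G (n - j) x))
    = (\<Sum>j\<le>Suc n. real (Suc n choose j) * (G (Suc n - j) x * H j x))" (is "?L = ?R")
  proof -
    \<comment> \<open>The added summand \<open>j = Suc n\<close> is zero because
      \<open>n choose Suc n = 0\<close>.\<close>
    have "(\<Sum>j\<le>n. real (n choose j) * (G (Suc (n - j)) x * H j x))
      = (\<Sum>j\<le>Suc n. real (n choose j) * (G (Suc n - j) x * H j x))"
      by (auto simp: Suc_diff_le intro!: sum.cong)
    also have "\<dots> = G (Suc n) x * H 0 x + (\<Sum>j\<le>n. real (n choose Suc j) * (G (n - j) x * H (Suc j) x))"
      by (subst sum.atMost_Suc_shift) simp
    finally have "?L = G (Suc n) x * H 0 x + (\<Sum>j\<le>n. real (n choose Suc j) * (G (n - j) x * H (Suc j) x))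
       + (\<Sum>j\<le>n. real (n choose j) * (H (Suc j) x * G (n - j) x))"
      by (simp add: ring_distribs sum.distrib)
    also have "\<dots> = ?R"
      by (subst sum.atMost_Suc_shift) (simp add: sum.distrib ring_distribs mult_ac)
    finally show ?thesis .
  qed
  ultimately show ?thesis by simp
qed

section \<open>Comparison and interpolation on an interval\<close>

text \<open>At an interior positive maximum of \<open>w - B\<close> the first derivatives agree and
  \<open>conv\<close> makes the second derivative of the difference positive, which is absurd. Since
  \<open>conv\<close> is demanded only at such critical points, first order terms of an equation
  cancel when it is verified.\<close>

lemma maximum_principle:
  fixes w B w1 B1 w2 B2 :: "real \<Rightarrow> real"
  assumes "l < r" and cont: "continuous_on {l..r} w" "continuous_on {l..r} B"
    and d1: "\<And>x. x \<in> {l<..<r} \<Longrightarrow> (w has_real_derivative w1 x) (at x)"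
      "\<And>x. x \<in> {l<..<r} \<Longrightarrow> (B has_real_derivative B1 x) (at x)"
    and d2: "\<And>x. x \<in> {l<..<r} \<Longrightarrow> (w1 has_real_derivative w2 x) (at x)"
      "\<And>x. x \<in> {l<..<r} \<Longrightarrow> (B1 has_real_derivative B2 x) (at x)"
    and bdry: "w l \<le> B l" "w r \<le> B r"
    and conv: "\<And>x. x \<in> {l<..<r} \<Longrightarrow> B x < w x \<Longrightarrow> w1 x = B1 x \<Longrightarrow> B2 x < w2 x"
    and x: "x \<in> {l..r}"
  shows "w x \<le> B x"
proof (rule ccontr)
  assume neg: "\<not> w x \<le> B x"
  let ?z = "\<lambda>x. w x - B x"
  have "continuous_on {l..r} ?z"
    using cont by (intro continuous_intros)
  then obtain y where y: "y \<in> {l..r}" "\<And>t. t \<in> {l..r} \<Longrightarrow> ?z t \<le> ?z y"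
    using continuous_attains_sup[of "{l..r}" ?z] \<open>l < r\<close> by auto
  have pos: "B y < w y"
    using neg y(2)[OF x] by simp
  then have yi: "y \<in> {l<..<r}"
    using y(1) bdry by (auto simp: less_le)
  have dz: "(?z has_real_derivative w1 t - B1 t) (at t)" if "t \<in> {l<..<r}" for t
    using d1 that by (intro derivative_intros) auto
  have "w1 y - B1 y = 0"
  proof (rule DERIV_local_max[OF dz[OF yi]])
    show "0 < min (y - l) (r - y)" using yi by auto
    show "\<forall>t. \<bar>y - t\<bar> < min (y - l) (r - y) \<longrightarrow> ?z t \<le> ?z y"
      using y(2) yi by (auto intro!: y(2))
  qed
  then have zero: "w1 y = B1 y" by simp
  have "((\<lambda>t. w1 t - B1 t) has_real_derivative w2 y - B2 y) (at y)"
    using d2 yi by (intro derivative_intros) auto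
  moreover have "0 < w2 y - B2 y"
    using conv[OF yi pos zero] by simp
  \<comment> \<open>Continuity of \<open>w2\<close> is not assumed: a positive derivative of
    \<open>w1 - B1\<close> at the single point \<open>y\<close>, where it vanishes, makes it
    positive just to the right, so \<open>w - B\<close> increases there.\<close>
  ultimately obtain d where d: "d > 0" "\<And>h. 0 < h \<Longrightarrow> h < d \<Longrightarrow> w1 y - B1 y < w1 (y + h) - B1 (y + h)"
    using DERIV_pos_inc_right[of "\<lambda>t. w1 t - B1 t"] by metis
  define h where "h = min d (r - y) / 2"
  have h: "0 < h" "h < d" "y + h < r"
    using d(1) yi by (auto simp: h_def min_def field_simps)
  have "?z y < ?z (y + h)"
  proof (rule DERIV_pos_imp_increasing_open[of y "y + h" ?z])
    show "\<exists>m. (?z has_real_derivative m) (at t) \<and> 0 < m" if "y < t" "t < y + h" for t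
      using d(2)[of "t - y"] dz[of t] that h yi zero by (intro exI[of _ "w1 t - B1 t"]) auto
    show "continuous_on {y..y + h} ?z"
      by (rule continuous_on_subset[OF \<open>continuous_on {l..r} ?z\<close>]) (use yi h in auto)
  qed (use h in auto)
  moreover have "?z (y + h) \<le> ?z y"
    using yi h by (intro y(2)) auto
  ultimately show False by simp
qed

text \<open>Interpolation by absorption: on a short window around a maximum of
  \<open>\<bar>g'\<bar>\<close> the mean value theorem yields a point where \<open>g'\<close> is
  controlled by \<open>m\<close>, and the bound on \<open>g''\<close> limits how far
  \<open>g'\<close> can move away from it.\<close>

lemma first_derivative_bound:
  fixes g g' g'' :: "real \<Rightarrow> real"
  assumes d1: "\<And>x. x \<in> {c..c + h} \<Longrightarrow> (g has_real_derivative g' x) (at x within {c..c + h})"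
    and d2: "\<And>x. x \<in> {c..c + h} \<Longrightarrow> (g' has_real_derivative g'' x) (at x within {c..c + h})"
    and g: "\<And>x. x \<in> {c..c + h} \<Longrightarrow> \<bar>g x\<bar> \<le> m"
    and dd: "\<And>x. x \<in> {c..c + h} \<Longrightarrow> \<bar>g'' x\<bar> \<le> P / h * \<bar>g' x\<bar> + G / h\<^sup>2"
    and h: "0 < h" and P: "1 \<le> P" and "0 \<le> G" and x: "x \<in> {c..c + h}"
  shows "\<bar>g' x\<bar> \<le> (8 * m * P + G) / h"
proof -
  have "continuous_on {c..c + h} g'"
    using d2 by (rule DERIV_continuous_on)
  then have "continuous_on {c..c + h} (\<lambda>x. \<bar>g' x\<bar>)"
    by (intro continuous_intros)
  then obtain y where y: "y \<in> {c..c + h}" "\<And>t. t \<in> {c..c + h} \<Longrightarrow> \<bar>g' t\<bar> \<le> \<bar>g' y\<bar>"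
    using continuous_attains_sup[of "{c..c + h}" "\<lambda>x. \<bar>g' x\<bar>"] h by auto
  \<comment> \<open>With this length the term \<open>P / h * \<bar>g' y\<bar>\<close> contributes
    exactly half of \<open>\<bar>g' y\<bar>\<close>, which can be moved to the left-hand side. As
    \<open>h' \<le> h / 2\<close>, a window of this length fits to the right or to the left of
    \<open>y\<close>.\<close>
  define h' where "h' = h / (2 * P)"
  have h': "0 < h'" "h' \<le> h / 2"
    using h P by (auto simp: h'_def field_simps)
  obtain s where s: "c \<le> s" "s + h' \<le> c + h" "s \<le> y" "y \<le> s + h'"
  proof (cases "y + h' \<le> c + h")
    case True
    then show ?thesis using that[of y] y(1) h' by auto
  next
    case False
    then show ?thesis using that[of "y - h'"] y(1) h' by auto
  qed
  have sub: "{s..s + h'} \<subseteq> {c..c + h}"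
    using s by auto
  obtain t where t: "t \<in> {s<..<s + h'}" "g (s + h') - g s = g' t * h'"
  proof -
    have "\<exists>t\<in>{s<..<s + h'}. g (s + h') - g s = (*) (g' t) (s + h' - s)"
    proof (rule mvt_simple)
      show "(g has_derivative (*) (g' t)) (at t within {s..s + h'})" if "s \<le> t" "t \<le> s + h'" for t
        using DERIV_subset[OF d1 sub, of t] that sub
        by (auto simp: has_field_derivative_def)
    qed (use h' in auto)
    then show ?thesis using that by auto
  qed
  have "\<bar>g' t\<bar> * h' \<le> 2 * m"
  proof -
    have "\<bar>g (s + h') - g s\<bar> \<le> 2 * m"
      using g[of s] g[of "s + h'"] h' s by auto
    then show ?thesis
      using h'(1) by (simp add: t(2) abs_mult)
  qed
  have "\<bar>g' y - g' t\<bar> \<le> (P / h * \<bar>g' y\<bar> + G / h\<^sup>2) * \<bar>y - t\<bar>"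
  proof -
    have "norm (g' y - g' t) \<le> (P / h * \<bar>g' y\<bar> + G / h\<^sup>2) * norm (y - t)"
    proof (rule field_differentiable_bound[of "{c..c + h}" g' g''])
      fix z assume z: "z \<in> {c..c + h}"
      show "(g' has_real_derivative g'' z) (at z within {c..c + h})" by (rule d2[OF z])
      have "\<bar>g'' z\<bar> \<le> P / h * \<bar>g' z\<bar> + G / h\<^sup>2" by (rule dd[OF z])
      also have "\<dots> \<le> P / h * \<bar>g' y\<bar> + G / h\<^sup>2"
        using y(2)[OF z] P h by (intro add_right_mono mult_left_mono) auto
      finally show "norm (g'' z) \<le> P / h * \<bar>g' y\<bar> + G / h\<^sup>2" by simp
    qed (use y t sub in auto)
    then show ?thesis by simp
  qed
  also have "\<dots> \<le> (P / h * \<bar>g' y\<bar> + G / h\<^sup>2) * h'"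
    using t(1) s P h \<open>0 \<le> G\<close> by (intro mult_left_mono) auto
  also have "\<dots> = \<bar>g' y\<bar> / 2 + G / (2 * P * h)"
    using P h by (simp add: h'_def field_simps power2_eq_square)
  also have "G / (2 * P * h) = G / (P * h) / 2"
    by simp
  finally have "\<bar>g' y\<bar> \<le> 2 * \<bar>g' t\<bar> + G / (P * h)"
    using abs_triangle_ineq2[of "g' y" "g' t"] by argo
  also have "\<bar>g' t\<bar> \<le> 4 * m * P / h"
    using \<open>\<bar>g' t\<bar> * h' \<le> 2 * m\<close> P h by (simp add: h'_def field_simps)
  also have "G / (P * h) \<le> G / h"
    using P h \<open>0 \<le> G\<close> by (intro divide_left_mono) auto
  finally have "\<bar>g' y\<bar> \<le> (8 * m * P + G) / h"
    by (simp add: add_divide_distrib)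
  with y(2)[OF x] show ?thesis by simp
qed

section \<open>Regularity of solutions up to the end points\<close>

text \<open>With Q' = p/\<epsilon>, the integrating factor exp(-Q) turns the equation into (u'
  exp(-Q))' = exp(-Q) (b u - f)/\<epsilon>. The right-hand side is continuous on the closed
  interval, so u' extends to the end points.\<close>

lemma bvp_solution_C1:
  assumes \<epsilon>: "0 < \<epsilon>" and u: "bvp_solution \<epsilon> p b f u_L u_R u"
    and cont: "continuous_on {0..1} p" "continuous_on {0..1} b" "continuous_on {0..1} f"
  obtains v where
    "\<And>x. x \<in> {0..1} \<Longrightarrow> (u has_real_derivative v x) (at x within {0..1})"
    "\<And>x. x \<in> {0..1} \<Longrightarrow>
      (v has_real_derivative (p x * v x + b x * u x - f x) / \<epsilon>) (at x within {0..1})"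
proof -
  have cu: "continuous_on {0..1} u"
    and du: "\<And>x. x \<in> {0<..<1} \<Longrightarrow> (u has_real_derivative deriv u x) (at x)"
    and ddu: "\<And>x. x \<in> {0<..<1} \<Longrightarrow> (deriv u has_real_derivative (p x * deriv u x + b x * u x - f x) / \<epsilon>) (at x)"
  proof -
    fix x :: real assume x: "x \<in> {0<..<1}"
    show "(u has_real_derivative deriv u x) (at x)"
      using u x by (auto simp: bvp_solution_def DERIV_deriv_iff_real_differentiable)
    have "(deriv u has_real_derivative deriv (deriv u) x) (at x)"
      using u x by (auto simp: bvp_solution_def DERIV_deriv_iff_real_differentiable)
    moreover have "deriv (deriv u) x = (p x * deriv u x + b x * u x - f x) / \<epsilon>"
      using u x \<epsilon> by (auto simp: bvp_solution_def field_simps)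
    ultimately show "(deriv u has_real_derivative (p x * deriv u x + b x * u x - f x) / \<epsilon>) (at x)"
      by simp
  qed (use u in \<open>simp add: bvp_solution_def\<close>)
  have "continuous_on {0..1} (\<lambda>x. p x / \<epsilon>)"
    using cont \<epsilon> by (intro continuous_intros) auto
  then obtain Q where Q: "\<And>x. x \<in> {0..1} \<Longrightarrow> (Q has_real_derivative p x / \<epsilon>) (at x within {0..1})"
    by (rule antiderivative_continuous) (auto simp: has_real_derivative_iff_has_vector_derivative)
  have cQ: "continuous_on {0..1} Q"
    using Q by (rule DERIV_continuous_on)
  have "continuous_on {0..1} (\<lambda>x. exp (- Q x) * (b x * u x - f x) / \<epsilon>)"
    using cont cu cQ \<epsilon> by (intro continuous_intros) auto
  then obtain R where R: "\<And>x. x \<in> {0..1} \<Longrightarrow>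
      (R has_real_derivative exp (- Q x) * (b x * u x - f x) / \<epsilon>) (at x within {0..1})"
    by (rule antiderivative_continuous) (auto simp: has_real_derivative_iff_has_vector_derivative)
  have inner: "at x within {0..1} = at x" if "x \<in> {0<..<1}" for x :: real
    using that by (intro at_within_Icc_at) auto
  have "\<exists>c. \<forall>x\<in>{0<..<1}. deriv u x * exp (- Q x) - R x = c"
  proof (rule has_field_derivative_zero_constant)
    fix x :: real assume x: "x \<in> {0<..<1}"
    have "(Q has_real_derivative p x / \<epsilon>) (at x)"
      "(R has_real_derivative exp (- Q x) * (b x * u x - f x) / \<epsilon>) (at x)"
      using Q[of x] R[of x] x inner[OF x] by auto
    then have "((\<lambda>x. deriv u x * exp (- Q x) - R x) has_real_derivative 0) (at x)"
      using ddu[OF x] by (auto intro!: derivative_eq_intros simp: add_divide_distrib diff_divide_distrib algebra_simps)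
    then show "((\<lambda>x. deriv u x * exp (- Q x) - R x) has_real_derivative 0) (at x within {0<..<1})"
      by (rule has_field_derivative_at_within)
  qed simp
  then obtain c where c: "\<And>x. x \<in> {0<..<1} \<Longrightarrow> deriv u x * exp (- Q x) - R x = c"
    by blast
  \<comment> \<open>The formula makes sense on all of [0,1] and equals u' inside; comparing u with
    an antiderivative of \<open>v\<close> then gives the one-sided derivatives of u.\<close>
  define v where "v x = exp (Q x) * (R x + c)" for x
  have uv: "deriv u x = v x" if "x \<in> {0<..<1}" for x
    using c[OF that] by (simp add: v_def exp_minus field_simps)
  have dv: "(v has_real_derivative (p x * v x + b x * u x - f x) / \<epsilon>) (at x within {0..1})"
    if "x \<in> {0..1}" for x
    unfolding v_def
    by (rule derivative_eq_intros Q[OF that] R[OF that] refl)+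
      (use \<epsilon> in \<open>simp add: field_simps exp_minus\<close>)
  then have "continuous_on {0..1} v"
    by (rule DERIV_continuous_on)
  then obtain W where W: "\<And>x. x \<in> {0..1} \<Longrightarrow> (W has_real_derivative v x) (at x within {0..1})"
    by (rule antiderivative_continuous) (auto simp: has_real_derivative_iff_has_vector_derivative)
  have "u x - W x = u 0 - W 0" if "x \<in> {0..1}" for x
  proof (rule DERIV_isconst2[of 0 1])
    show "continuous_on {0..1} (\<lambda>x. u x - W x)"
      using cu DERIV_continuous_on[OF W] by (intro continuous_intros) auto
    show "((\<lambda>x. u x - W x) has_real_derivative 0) (at x)" if "0 < x" "x < 1" for x
      using du[of x] W[of x] inner[of x] uv[of x] that
      by (auto intro!: derivative_eq_intros)
  qed (use that in auto)
  then have uW: "W x + (u 0 - W 0) = u x" if "x \<in> {0..1}" for x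
    using that by (auto simp: algebra_simps)
  have "(u has_real_derivative v x) (at x within {0..1})" if "x \<in> {0..1}" for x
  proof (rule has_field_derivative_transform_within[where d = 1 and f = "\<lambda>x. W x + (u 0 - W 0)"])
    show "((\<lambda>x. W x + (u 0 - W 0)) has_real_derivative v x) (at x within {0..1})"
      by (auto intro!: derivative_eq_intros W that)
  qed (use that uW in auto)
  with dv that show thesis by blast
qed

text \<open>Bootstrapping: the n times differentiated equation expresses the derivative of order n+2
  through orders at most n+1, hence through differentiable functions.\<close>

lemma bvp_solution_higher_derivatives:
  defines "D \<equiv> nth_deriv_within {0..1}"
  assumes \<epsilon>: "0 < \<epsilon>" and u: "bvp_solution \<epsilon> p b f u_L u_R u"
    and smooth: "smooth_within {0..1} p" "smooth_within {0..1} b" "smooth_within {0..1} f"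
    and "x \<in> {0..1}"
  shows "(D n u has_real_derivative D (Suc n) u x) (at x within {0..1})"
    and "\<epsilon> * D (Suc (Suc n)) u x =
      (\<Sum>j\<le>n. real (n choose j) * (D (n - j) p x * D (Suc j) u x))
      + (\<Sum>j\<le>n. real (n choose j) * (D (n - j) b x * D j u x)) - D n f x"
proof -
  define E where "E n x = ((\<Sum>j\<le>n. real (n choose j) * (D (n - j) p x * D (Suc j) u x))
      + (\<Sum>j\<le>n. real (n choose j) * (D (n - j) b x * D j u x)) - D n f x) / \<epsilon>" for n x
  note dD = smooth_within_has_derivative[OF smooth(1), folded D_def]
    smooth_within_has_derivative[OF smooth(2), folded D_def]
    smooth_within_has_derivative[OF smooth(3), folded D_def]
  have D0: "D 0 g = g" for g
    by (simp add: D_def)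
  have D_Suc: "(D n g has_real_derivative D (Suc n) g x) (at x within {0..1})" "D (Suc n) g x = d"
    if "(D n g has_real_derivative d) (at x within {0..1})" "x \<in> {0..1}" for n g x d
    using nth_deriv_within_Suc_eq[of 0 1 n g d x] that by (auto simp: D_def)
  have "continuous_on {0..1} p" "continuous_on {0..1} b" "continuous_on {0..1} f"
    using DERIV_continuous_on[OF dD(1)[of _ 0]] DERIV_continuous_on[OF dD(2)[of _ 0]]
      DERIV_continuous_on[OF dD(3)[of _ 0]] by (simp_all add: D0)
  then obtain v where
    v: "\<And>x. x \<in> {0..1} \<Longrightarrow> (u has_real_derivative v x) (at x within {0..1})"
      "\<And>x. x \<in> {0..1} \<Longrightarrow> (v has_real_derivative (p x * v x + b x * u x - f x) / \<epsilon>) (at x within {0..1})"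
    using bvp_solution_C1[OF \<epsilon> u] by metis
  have cong: "(g has_real_derivative d) (at x within {0..1})"
    if "(h has_real_derivative d) (at x within {0..1})" "x \<in> {0..1}" "\<And>x. x \<in> {0..1} \<Longrightarrow> h x = g x"
    for g h d x
    by (rule has_field_derivative_transform_within[OF that(1), of 1]) (use that in auto)
  have u1: "D (Suc 0) u x = v x" if "x \<in> {0..1}" for x
    using D_Suc(2)[of 0 u "v x" x] v(1)[OF that] that by (simp add: D0)
  \<comment> \<open>The identity is carried along for all points at once, since it is differentiated
    in the induction step.\<close>
  have *: "\<forall>x\<in>{0..1}. (\<forall>i\<le>Suc n. (D i u has_real_derivative D (Suc i) u x) (at x within {0..1}))
      \<and> D (Suc (Suc n)) u x = E n x" for n
  proof (induction n)
    case 0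
    show ?case
    proof
      fix x :: real assume x: "x \<in> {0..1}"
      have du: "(D (Suc 0) u has_real_derivative E 0 x) (at x within {0..1})"
        using cong[OF v(2)[OF x] x, of "D (Suc 0) u"] u1 x by (simp add: E_def D0)
      moreover have "(D 0 u has_real_derivative D (Suc 0) u x) (at x within {0..1})"
        using D_Suc(1)[of 0 u "v x" x] v(1) x by (simp add: D0)
      ultimately show "(\<forall>i\<le>Suc 0. (D i u has_real_derivative D (Suc i) u x) (at x within {0..1}))
        \<and> D (Suc (Suc 0)) u x = E 0 x"
        using D_Suc[OF du x] by (auto simp: le_Suc_eq)
    qed
  next
    case (Suc n)
    show ?case
    proof
      fix x :: real assume x: "x \<in> {0..1}"
      have du: "(D i u has_real_derivative D (Suc i) u x) (at x within {0..1})" if "i \<le> Suc n" for i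
        using Suc x that by auto
      have "(E n has_real_derivative E (Suc n) x) (at x within {0..1})"
        unfolding E_def
        by (intro DERIV_cdivide DERIV_diff DERIV_add has_real_derivative_Leibniz dD x du
            has_real_derivative_Leibniz[where H = "\<lambda>j. D (Suc j) u"]) auto
      then have "(D (Suc (Suc n)) u has_real_derivative E (Suc n) x) (at x within {0..1})"
        by (rule cong[OF _ x]) (use Suc in auto)
      from D_Suc[OF this x] du
      show "(\<forall>i\<le>Suc (Suc n). (D i u has_real_derivative D (Suc i) u x) (at x within {0..1}))
        \<and> D (Suc (Suc (Suc n))) u x = E (Suc n) x"
        by (auto simp: le_Suc_eq)
    qed
  qed
  show "(D n u has_real_derivative D (Suc n) u x) (at x within {0..1})"
    using *[of n] \<open>x \<in> {0..1}\<close> by auto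
  show "\<epsilon> * D (Suc (Suc n)) u x =
      (\<Sum>j\<le>n. real (n choose j) * (D (n - j) p x * D (Suc j) u x))
      + (\<Sum>j\<le>n. real (n choose j) * (D (n - j) b x * D j u x)) - D n f x"
    using *[of n] \<open>x \<in> {0..1}\<close> \<epsilon> by (auto simp: E_def)
qed

lemma bvp_solution_smooth_within:
  assumes "0 < \<epsilon>" "bvp_solution \<epsilon> p b f u_L u_R u"
    and "smooth_within {0..1} p" "smooth_within {0..1} b" "smooth_within {0..1} f"
  shows "smooth_within {0..1} u"
  using bvp_solution_higher_derivatives(1)[OF assms]
  unfolding smooth_within_def real_differentiable_def by (metis)

text \<open>Only part of the binomial row is summed because the leading terms of the Leibniz sums
  are split off; the full row adds up to \<open>2 ^ n\<close>.\<close>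

lemma abs_binomial_sum_le:
  fixes g h :: "nat \<Rightarrow> real"
  assumes "A \<subseteq> {..n}" "\<And>j. j \<in> A \<Longrightarrow> \<bar>g j\<bar> \<le> m" "\<And>j. j \<in> A \<Longrightarrow> \<bar>h j\<bar> \<le> z" "0 \<le> m" "0 \<le> z"
  shows "\<bar>\<Sum>j\<in>A. real (n choose j) * (g j * h j)\<bar> \<le> 2 ^ n * (m * z)"
proof -
  have "\<bar>\<Sum>j\<in>A. real (n choose j) * (g j * h j)\<bar> \<le> (\<Sum>j\<in>A. real (n choose j) * (m * z))"
    using assms by (intro sum_abs[THEN order_trans] sum_mono) (auto simp: abs_mult intro!: mult_mono)
  also have "\<dots> \<le> (\<Sum>j\<le>n. real (n choose j) * (m * z))"
    using assms by (intro sum_mono2) auto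
  also have "\<dots> = 2 ^ n * (m * z)"
    by (simp add: choose_row_sum flip: sum_distrib_right of_nat_sum)
  finally show ?thesis .
qed

declare nth_deriv_within.simps(2) [simp del]

section \<open>Estimates uniform in \<epsilon>: the differentiated equation and the end
  points\<close>

text \<open>Everything fixed here is independent of \<epsilon>, so constants built from it are
  admissible. The range up to \<open>N + 2\<close> ensures that p'', needed for the barrier, is
  bounded even when \<open>N = 0\<close>.\<close>

locale turning_point_problem =
  fixes p b f :: "real \<Rightarrow> real" and u_L u_R b\<^sub>0 \<alpha> M :: real and N :: nat
  assumes smooth: "smooth_within {0..1} p" "smooth_within {0..1} b" "smooth_within {0..1} f"
    and p_0: "p 0 = 0"
    and \<alpha>_pos: "0 < \<alpha>"
    and dp_ge: "\<And>x. x \<in> {0..1} \<Longrightarrow> \<alpha> \<le> nth_deriv_within {0..1} 1 p x"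
    and b\<^sub>0_pos: "0 < b\<^sub>0"
    and b_ge: "\<And>x. x \<in> {0..1} \<Longrightarrow> b\<^sub>0 \<le> b x"
    and M_ge_1: "1 \<le> M"
    and M_bound: "\<And>i x. i \<le> N + 2 \<Longrightarrow> x \<in> {0..1} \<Longrightarrow> \<bar>nth_deriv_within {0..1} i p x\<bar> \<le> M"
      "\<And>i x. i \<le> N + 2 \<Longrightarrow> x \<in> {0..1} \<Longrightarrow> \<bar>nth_deriv_within {0..1} i b x\<bar> \<le> M"
      "\<And>i x. i \<le> N + 2 \<Longrightarrow> x \<in> {0..1} \<Longrightarrow> \<bar>nth_deriv_within {0..1} i f x\<bar> \<le> M"
    and data_bound: "\<bar>u_L\<bar> \<le> M" "\<bar>u_R\<bar> \<le> M"
begin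

abbreviation "D \<equiv> nth_deriv_within {0..1}"

definition solution :: "real \<Rightarrow> (real \<Rightarrow> real) \<Rightarrow> bool" where
  "solution \<epsilon> u \<longleftrightarrow> 0 < \<epsilon> \<and> \<epsilon> \<le> 1 \<and> bvp_solution \<epsilon> p b f u_L u_R u"

lemma solution_derivative:
  assumes "solution \<epsilon> u" "x \<in> {0..1}"
  shows "(D n u has_real_derivative D (Suc n) u x) (at x within {0..1})"
  using bvp_solution_higher_derivatives(1)[OF _ _ smooth assms(2)] assms(1)
  by (auto simp: solution_def)

lemma D_bounds:
  assumes "x \<in> {0..1}"
  shows "\<bar>p x\<bar> \<le> M" "\<bar>b x\<bar> \<le> M" "\<bar>f x\<bar> \<le> M"
  using M_bound[of 0 x] assms by auto

lemma p_ge: "\<alpha> * x \<le> p x" and p_le: "p x \<le> M * x" if "x \<in> {0..1}"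
proof -
  have "\<exists>t\<in>{0<..<x}. p x - p 0 = (*) (D 1 p t) (x - 0)" if "0 < x"
  proof (rule mvt_simple[OF that])
    fix t assume t: "0 \<le> t" "t \<le> x"
    then have "(D 0 p has_real_derivative D 1 p t) (at t within {0..1})"
      using smooth_within_has_derivative[OF smooth(1), of t 0] \<open>x \<in> {0..1}\<close> by auto
    then have "(p has_real_derivative D 1 p t) (at t within {0..x})"
      using \<open>x \<in> {0..1}\<close> by (auto intro: DERIV_subset)
    then show "(p has_derivative (*) (D 1 p t)) (at t within {0..x})"
      by (simp add: has_field_derivative_def)
  qed
  then have "x = 0 \<or> (\<exists>t\<in>{0..1}. p x = D 1 p t * x)"
    using \<open>x \<in> {0..1}\<close> p_0 by force
  moreover have "\<alpha> * x \<le> D 1 p t * x \<and> D 1 p t * x \<le> M * x" if "t \<in> {0..1}" for t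
    using dp_ge[OF that] M_bound(1)[of 1 t] that \<open>x \<in> {0..1}\<close> by (auto intro!: mult_right_mono)
  ultimately show "\<alpha> * x \<le> p x" "p x \<le> M * x"
    using p_0 by auto
qed

lemma p_nonneg: "0 \<le> p x" if "x \<in> {0..1}"
  using p_ge[OF that] \<alpha>_pos that by (meson atLeastAtMost_iff less_imp_le mult_nonneg_nonneg order_trans)

text \<open>In the Leibniz sums, order k+1 comes only from \<open>j = k\<close> in the p-sum. Order
  k comes from \<open>j = k - 1\<close> there, with factor k, and from \<open>j = k\<close> in the
  b-sum. What remains are two partial binomial rows of lower orders, hence \<open>2 ^ Suc k\<close>,
  and the derivative of \<open>f\<close>.\<close>

lemma differentiated_equation:
  assumes u: "solution \<epsilon> u" and x: "x \<in> {0..1}" and "k \<le> N"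
    and z: "\<And>i. i < k \<Longrightarrow> \<bar>D i u x\<bar> \<le> z" "0 \<le> z"
  shows "\<bar>\<epsilon> * D (Suc (Suc k)) u x - (p x * D (Suc k) u x + (b x + k * D 1 p x) * D k u x)\<bar>
    \<le> M * (2 ^ Suc k * z + 1)"
proof -
  define P where "P = (\<Sum>j\<le>k. real (k choose j) * (D (k - j) p x * D (Suc j) u x))"
  define B where "B = (\<Sum>j\<le>k. real (k choose j) * (D (k - j) b x * D j u x))"
  have eq: "\<epsilon> * D (Suc (Suc k)) u x = P + B - D k f x"
    using bvp_solution_higher_derivatives(2)[OF _ _ smooth x] u
    by (auto simp: solution_def P_def B_def)
  have "\<bar>P - (p x * D (Suc k) u x + k * D 1 p x * D k u x)\<bar> \<le> 2 ^ k * (M * z)"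
  proof (cases k)
    case 0
    then show ?thesis using z M_ge_1 by (simp add: P_def)
  next
    case (Suc m)
    have "P - (p x * D (Suc k) u x + k * D 1 p x * D k u x) =
        (\<Sum>j<m. real (k choose j) * (D (k - j) p x * D (Suc j) u x))"
      by (simp add: P_def Suc lessThan_Suc_atMost[symmetric] algebra_simps)
    moreover have "\<bar>\<Sum>j<m. real (k choose j) * (D (k - j) p x * D (Suc j) u x)\<bar> \<le> 2 ^ k * (M * z)"
      using Suc \<open>k \<le> N\<close> x z M_ge_1 by (intro abs_binomial_sum_le M_bound) auto
    ultimately show ?thesis by simp
  qed
  moreover have "\<bar>B - b x * D k u x\<bar> \<le> 2 ^ k * (M * z)"
  proof -
    have "B - b x * D k u x = (\<Sum>j<k. real (k choose j) * (D (k - j) b x * D j u x))"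
      by (simp add: B_def lessThan_Suc_atMost[symmetric])
    moreover have "\<bar>\<Sum>j<k. real (k choose j) * (D (k - j) b x * D j u x)\<bar> \<le> 2 ^ k * (M * z)"
      using \<open>k \<le> N\<close> x z M_ge_1 by (intro abs_binomial_sum_le M_bound) auto
    ultimately show ?thesis by simp
  qed
  moreover have "\<bar>D k f x\<bar> \<le> M"
    using \<open>k \<le> N\<close> x by (intro M_bound) auto
  moreover have "M * (2 ^ Suc k * z + 1) = 2 ^ k * (M * z) + 2 ^ k * (M * z) + M"
    by (simp add: algebra_simps)
  ultimately show ?thesis
    unfolding eq by (simp add: algebra_simps)
qed

text \<open>
  Rescaling \<open>x = c + h t\<close> turns the equation into one with coefficients bounded independently of
  \<open>\<epsilon>\<close>; this is applied with \<open>c = 0\<close>, \<open>h = sqrt \<epsilon>\<close> and with \<open>c = 1 - \<epsilon>\<close>, \<open>h = \<epsilon>\<close>.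
\<close>
lemma layer_bound:
  assumes "n \<le> N" and m: "0 \<le> m"
  shows "\<exists>K\<ge>0. \<forall>\<epsilon> u c h. solution \<epsilon> u \<and> 0 < h \<and> h \<le> 1 \<and> h\<^sup>2 \<le> \<epsilon> \<and> {c..c + h} \<subseteq> {0..1} \<and>
      (\<forall>x\<in>{c..c + h}. \<bar>p x\<bar> \<le> M * \<epsilon> / h) \<and> (\<forall>x\<in>{0..1}. \<bar>u x\<bar> \<le> m) \<longrightarrow>
      (\<forall>i\<le>Suc n. \<forall>x\<in>{c..c + h}. \<bar>D i u x\<bar> \<le> K / h ^ i)"
  using \<open>n \<le> N\<close>
proof (induction n)
  case 0
  show ?case
  proof (intro exI[of _ "m + (8 * m * M + (M * m + M))"] conjI allI impI ballI; (elim conjE)?)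
    fix \<epsilon> u c h i x
    assume u: "solution \<epsilon> u" and h: "0 < h" "h \<le> 1" "h\<^sup>2 \<le> \<epsilon>" and sub: "{c..c + h} \<subseteq> {0..1}"
      and p: "\<forall>x\<in>{c..c + h}. \<bar>p x\<bar> \<le> M * \<epsilon> / h" and bu: "\<forall>x\<in>{0..1}. \<bar>u x\<bar> \<le> m"
      and i: "i \<le> Suc 0" and x: "x \<in> {c..c + h}"
    have \<epsilon>: "0 < \<epsilon>"
      using u by (simp add: solution_def)
    \<comment> \<open>After division by \<epsilon> the bound on \<open>p\<close> gives the
      coefficient \<open>M / h\<close>, and \<open>h\<^sup>2 \<le> \<epsilon>\<close> turns the
      other terms into \<open>(M * m + M) / h\<^sup>2\<close>.\<close>
    have "\<bar>D (Suc 0) u x\<bar> \<le> (8 * m * M + (M * m + M)) / h"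
    proof (rule first_derivative_bound[where g = "D 0 u" and g' = "D (Suc 0) u" and g'' = "D (Suc (Suc 0)) u"])
      fix t assume t: "t \<in> {c..c + h}"
      then have t1: "t \<in> {0..1}" using sub by auto
      show "(D 0 u has_real_derivative D (Suc 0) u t) (at t within {c..c + h})"
        by (rule DERIV_subset[OF solution_derivative[OF u t1] sub])
      show "(D (Suc 0) u has_real_derivative D (Suc (Suc 0)) u t) (at t within {c..c + h})"
        by (rule DERIV_subset[OF solution_derivative[OF u t1] sub])
      show "\<bar>D 0 u t\<bar> \<le> m"
        using bu t sub by auto
      have "\<epsilon> * \<bar>D (Suc (Suc 0)) u t\<bar> = \<bar>\<epsilon> * D (Suc (Suc 0)) u t\<bar>"
        using \<epsilon> by (simp add: abs_mult)
      also have "\<dots> = \<bar>p t * D (Suc 0) u t + b t * u t - f t\<bar>"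
        using bvp_solution_higher_derivatives(2)[OF \<epsilon> _ smooth t1, of u_L u_R u 0] u \<epsilon>
        by (simp add: solution_def)
      also have "\<dots> \<le> \<bar>p t\<bar> * \<bar>D (Suc 0) u t\<bar> + \<bar>b t\<bar> * \<bar>u t\<bar> + \<bar>f t\<bar>"
        by (simp flip: abs_mult)
      also have "\<dots> \<le> M * \<epsilon> / h * \<bar>D (Suc 0) u t\<bar> + M * m + M"
        using p t t1 bu D_bounds[OF t1] M_ge_1 by (intro add_mono mult_mono) auto
      also have "\<dots> \<le> M * \<epsilon> / h * \<bar>D (Suc 0) u t\<bar> + \<epsilon> * ((M * m + M) / h\<^sup>2)"
      proof -
        have "(M * m + M) * h\<^sup>2 \<le> (M * m + M) * \<epsilon>"
          using h m M_ge_1 by (intro mult_left_mono) auto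
        then have "M * m + M \<le> (M * m + M) * \<epsilon> / h\<^sup>2"
          using h by (subst pos_le_divide_eq) auto
        moreover have "\<epsilon> * ((M * m + M) / h\<^sup>2) = (M * m + M) * \<epsilon> / h\<^sup>2"
          by simp
        ultimately show ?thesis by linarith
      qed
      also have "\<dots> = \<epsilon> * (M / h * \<bar>D (Suc 0) u t\<bar> + (M * m + M) / h\<^sup>2)"
        by (simp add: algebra_simps)
      finally show "\<bar>D (Suc (Suc 0)) u t\<bar> \<le> M / h * \<bar>D (Suc 0) u t\<bar> + (M * m + M) / h\<^sup>2"
        using \<epsilon> by simp
    qed (use h x M_ge_1 m in auto)
    also have "\<dots> \<le> (m + (8 * m * M + (M * m + M))) / h"
      using h m by (intro divide_right_mono) auto
    finally have *: "\<bar>D (Suc 0) u x\<bar> \<le> (m + (8 * m * M + (M * m + M))) / h" .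
    have "\<bar>u x\<bar> \<le> m" using bu x sub by auto
    also have "m \<le> m + (8 * m * M + (M * m + M))" using m M_ge_1 by simp
    finally show "\<bar>D i u x\<bar> \<le> (m + (8 * m * M + (M * m + M))) / h ^ i"
      using * i by (auto simp: le_Suc_eq)
  qed (use m M_ge_1 in auto)
next
  case (Suc n)
  then obtain K where K: "0 \<le> K" and
    IH: "\<And>\<epsilon> u c h i x. solution \<epsilon> u \<Longrightarrow> 0 < h \<Longrightarrow> h \<le> 1 \<Longrightarrow> h\<^sup>2 \<le> \<epsilon> \<Longrightarrow> {c..c + h} \<subseteq> {0..1} \<Longrightarrow>
      \<forall>x\<in>{c..c + h}. \<bar>p x\<bar> \<le> M * \<epsilon> / h \<Longrightarrow> \<forall>x\<in>{0..1}. \<bar>u x\<bar> \<le> m \<Longrightarrow>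
      i \<le> Suc n \<Longrightarrow> x \<in> {c..c + h} \<Longrightarrow> \<bar>D i u x\<bar> \<le> K / h ^ i"
    by fastforce
  \<comment> \<open>\<open>L\<close> gathers all contributions of size \<open>1 / h ^ n\<close>.
    They equal \<open>h\<^sup>2 * (L / h ^ (n + 2))\<close>, so
    \<open>h\<^sup>2 \<le> \<epsilon>\<close> lets them survive the division by \<epsilon>.\<close>
  define L where "L = (M + real n * M) * K + M * (2 ^ Suc n * K + 1)"
  have L: "0 \<le> L"
    unfolding L_def using K M_ge_1 by (intro add_nonneg_nonneg mult_nonneg_nonneg) auto
  show ?case
  proof (intro exI[of _ "K + (M * K + L)"] conjI allI impI ballI; (elim conjE)?)
    fix \<epsilon> u c h i x
    assume u: "solution \<epsilon> u" and h: "0 < h" "h \<le> 1" "h\<^sup>2 \<le> \<epsilon>" and sub: "{c..c + h} \<subseteq> {0..1}"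
      and p: "\<forall>x\<in>{c..c + h}. \<bar>p x\<bar> \<le> M * \<epsilon> / h" and bu: "\<forall>x\<in>{0..1}. \<bar>u x\<bar> \<le> m"
      and i: "i \<le> Suc (Suc n)" and x: "x \<in> {c..c + h}"
    have x1: "x \<in> {0..1}" using x sub by auto
    have \<epsilon>: "0 < \<epsilon>"
      using u by (simp add: solution_def)
    have *: "\<bar>D j u x\<bar> \<le> K / h ^ j" if "j \<le> Suc n" for j
      using IH[OF u h sub p bu that x] .
    show "\<bar>D i u x\<bar> \<le> (K + (M * K + L)) / h ^ i"
    proof (cases "i \<le> Suc n")
      case True
      have "K / h ^ i \<le> (K + (M * K + L)) / h ^ i"
        using h K L M_ge_1 by (intro divide_right_mono) auto
      with *[OF True] show ?thesis by simp
    next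
      case False
      then have i: "i = Suc (Suc n)" using i by simp
      define w where "w = p x * D (Suc n) u x + (b x + n * D 1 p x) * D n u x"
      have "\<bar>D j u x\<bar> \<le> K / h ^ n" if "j < n" for j
      proof -
        have "K / h ^ j \<le> K / h ^ n"
          using h K that by (intro divide_left_mono power_decreasing) auto
        with *[of j] that show ?thesis by simp
      qed
      then have "\<bar>\<epsilon> * D i u x - w\<bar> \<le> M * (2 ^ Suc n * (K / h ^ n) + 1)"
        unfolding i w_def using Suc.prems K h
        by (intro differentiated_equation u x1) auto
      also have "\<dots> \<le> M * (2 ^ Suc n * (K / h ^ n) + 1 / h ^ n)"
        using M_ge_1 h by (intro mult_left_mono add_left_mono) (auto simp: power_le_one)
      finally have 1: "\<bar>\<epsilon> * D i u x - w\<bar> \<le> M * (2 ^ Suc n * (K / h ^ n) + 1 / h ^ n)" .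
      have "\<bar>w\<bar> \<le> \<bar>p x\<bar> * \<bar>D (Suc n) u x\<bar> + (\<bar>b x\<bar> + real n * \<bar>D 1 p x\<bar>) * \<bar>D n u x\<bar>"
        unfolding w_def
        by (intro abs_triangle_ineq[THEN order_trans] add_mono)
          (auto simp: abs_mult intro!: mult_right_mono abs_triangle_ineq[THEN order_trans])
      also have "\<dots> \<le> M * \<epsilon> / h * (K / h ^ Suc n) + (M + real n * M) * (K / h ^ n)"
        using p x *[of n] *[of "Suc n"] D_bounds[OF x1] M_bound(1)[of 1 x] x1 M_ge_1 h \<epsilon> K
        by (intro add_mono mult_mono) auto
      finally have "\<epsilon> * \<bar>D i u x\<bar> \<le> M * \<epsilon> / h * (K / h ^ Suc n) + (M + real n * M) * (K / h ^ n)
          + M * (2 ^ Suc n * (K / h ^ n) + 1 / h ^ n)"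
        using 1 \<epsilon> by (simp add: abs_mult_pos'[symmetric])
      also have "\<dots> = \<epsilon> * (M * K / h ^ i) + h\<^sup>2 * (L / h ^ i)"
        using h by (simp add: L_def i field_simps power2_eq_square)
      also have "\<dots> \<le> \<epsilon> * (M * K / h ^ i) + \<epsilon> * (L / h ^ i)"
        using h L by (intro add_left_mono mult_right_mono) auto
      also have "\<dots> = \<epsilon> * ((M * K + L) / h ^ i)"
        by (simp add: add_divide_distrib distrib_left)
      finally have "\<bar>D i u x\<bar> \<le> (M * K + L) / h ^ i"
        using \<epsilon> by (simp only: mult_le_cancel_left_pos)
      also have "\<dots> \<le> (K + (M * K + L)) / h ^ i"
        using h K by (intro divide_right_mono) auto
      finally show ?thesis .
    qed
  qed (use K L M_ge_1 in auto)
qed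

text \<open>The requirement \<open>\<bar>p x\<bar> \<le> M * \<epsilon> / h\<close> selects the
  widths: near 0, where p is at most M x, it allows \<open>h = sqrt \<epsilon>\<close>; near 1,
  where p is only known to be at most M, it forces \<open>h = \<epsilon>\<close>.\<close>

lemma boundary_bound:
  assumes "n \<le> N" and m: "0 \<le> m" and bu: "\<And>\<epsilon> u x. solution \<epsilon> u \<Longrightarrow> x \<in> {0..1} \<Longrightarrow> \<bar>u x\<bar> \<le> m"
  shows "\<exists>K\<ge>0. \<forall>\<epsilon> u. solution \<epsilon> u \<longrightarrow> \<bar>D n u 0\<bar> \<le> K / sqrt \<epsilon> ^ n \<and> \<bar>D n u 1\<bar> \<le> K / \<epsilon> ^ n"
proof -
  obtain K where K: "0 \<le> K" and
    layer: "\<And>\<epsilon> u c h i x. solution \<epsilon> u \<Longrightarrow> 0 < h \<Longrightarrow> h \<le> 1 \<Longrightarrow> h\<^sup>2 \<le> \<epsilon> \<Longrightarrow> {c..c + h} \<subseteq> {0..1} \<Longrightarrow>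
      \<forall>x\<in>{c..c + h}. \<bar>p x\<bar> \<le> M * \<epsilon> / h \<Longrightarrow> \<forall>x\<in>{0..1}. \<bar>u x\<bar> \<le> m \<Longrightarrow>
      i \<le> Suc n \<Longrightarrow> x \<in> {c..c + h} \<Longrightarrow> \<bar>D i u x\<bar> \<le> K / h ^ i"
    using layer_bound[OF \<open>n \<le> N\<close> m] by fastforce
  have "\<bar>D n u 0\<bar> \<le> K / sqrt \<epsilon> ^ n \<and> \<bar>D n u 1\<bar> \<le> K / \<epsilon> ^ n" if u: "solution \<epsilon> u" for \<epsilon> u
  proof
    have \<epsilon>: "0 < \<epsilon>" "\<epsilon> \<le> 1" using u by (auto simp: solution_def)
    show "\<bar>D n u 0\<bar> \<le> K / sqrt \<epsilon> ^ n"
    proof (rule layer[OF u, of "sqrt \<epsilon>" 0])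
      show "\<forall>x\<in>{0..0 + sqrt \<epsilon>}. \<bar>p x\<bar> \<le> M * \<epsilon> / sqrt \<epsilon>"
      proof
        fix x assume "x \<in> {0..0 + sqrt \<epsilon>}"
        moreover from this have x: "x \<in> {0..1}"
          using \<epsilon> by (auto intro: order_trans[of x "sqrt \<epsilon>"])
        moreover have "M * x \<le> M * sqrt \<epsilon>"
          using calculation M_ge_1 by (intro mult_left_mono) auto
        ultimately have "\<bar>p x\<bar> \<le> M * sqrt \<epsilon>"
          using p_le[OF x] p_nonneg[OF x] by auto
        then show "\<bar>p x\<bar> \<le> M * \<epsilon> / sqrt \<epsilon>"
          using \<epsilon> by (simp add: real_div_sqrt flip: times_divide_eq_right)
      qed
    qed (use \<epsilon> bu[OF u] in auto)
    show "\<bar>D n u 1\<bar> \<le> K / \<epsilon> ^ n"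
    proof (rule layer[OF u, of \<epsilon> "1 - \<epsilon>"])
      show "\<epsilon>\<^sup>2 \<le> \<epsilon>"
        using \<epsilon> by (simp add: power2_eq_square mult_left_le)
    qed (use \<epsilon> bu[OF u] D_bounds(1) in auto)
  qed
  with K show ?thesis by blast
qed

end

section \<open>The barrier function\<close>

lemma has_real_derivative_inverse_power:
  fixes g :: "real \<Rightarrow> real"
  assumes "(g has_real_derivative g') (at x within S)" "g x \<noteq> 0"
  shows "((\<lambda>x. 1 / g x ^ k) has_real_derivative - (real k * g') / g x ^ Suc k) (at x within S)"
proof (cases k)
  case (Suc m)
  show ?thesis
    by (rule derivative_eq_intros assms refl)+ (use assms(2) in \<open>simp_all add: Suc field_simps\<close>)
qed simp

context turning_point_problem
begin

text \<open>Chosen so that \<open>(N * M + N * (N + 1) * M\<^sup>2) / A \<le> b\<^sub>0 / 2\<close>: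
  the diffusion of \<open>1 / q \<epsilon> x ^ k\<close> then costs at most half of
  \<open>b\<close>, for every \<open>k \<le> N\<close>.\<close>

definition A :: real where
  "A = 1 + 2 * (N * M + N * (N + 1) * M\<^sup>2) / b\<^sub>0"

text \<open>The bound \<open>2 * c \<le> b\<^sub>0 / 2\<close> pays for the curvature of the
  exponent of \<open>\<phi>\<close>, and \<open>2 * c \<le> \<alpha>\<close> gives
  \<open>2 * c * x \<le> p x\<close>.\<close>

definition c :: real where
  "c = min (b\<^sub>0 / 4) (\<alpha> / 2)"

definition q :: "real \<Rightarrow> real \<Rightarrow> real" where
  "q \<epsilon> x = p x + A * sqrt \<epsilon>"

text \<open>The exponent is quadratic so that the logarithmic derivative
  \<open>2 * c * x / \<epsilon>\<close> vanishes at the turning point together with p and stays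
  below \<open>p x / \<epsilon>\<close> everywhere.\<close>

definition \<phi> :: "real \<Rightarrow> real \<Rightarrow> real" where
  "\<phi> \<epsilon> x = exp (- (c * (1 - x\<^sup>2) / \<epsilon>))"

definition barrier :: "nat \<Rightarrow> real \<Rightarrow> real \<Rightarrow> real" where
  "barrier k \<epsilon> x = 1 / q \<epsilon> x ^ k + \<phi> \<epsilon> x / \<epsilon> ^ k"

definition barrier1 :: "nat \<Rightarrow> real \<Rightarrow> real \<Rightarrow> real" where
  "barrier1 k \<epsilon> x = - (real k * D 1 p x) / q \<epsilon> x ^ Suc k + 2 * c * x / \<epsilon> * \<phi> \<epsilon> x / \<epsilon> ^ k"

definition barrier2 :: "nat \<Rightarrow> real \<Rightarrow> real \<Rightarrow> real" where
  "barrier2 k \<epsilon> x = - (real k * D 2 p x) / q \<epsilon> x ^ Suc k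
     + real k * real (Suc k) * (D 1 p x)\<^sup>2 / q \<epsilon> x ^ Suc (Suc k)
     + (2 * c / \<epsilon> + (2 * c * x / \<epsilon>)\<^sup>2) * \<phi> \<epsilon> x / \<epsilon> ^ k"

lemma A_ge_1: "1 \<le> A"
  using b\<^sub>0_pos M_ge_1 by (simp add: A_def)

lemma c_pos: "0 < c" and c_le: "4 * c \<le> b\<^sub>0" "2 * c \<le> \<alpha>"
  using b\<^sub>0_pos \<alpha>_pos by (auto simp: c_def min_def)

lemma q_bounds:
  assumes "0 < \<epsilon>" "\<epsilon> \<le> 1" "x \<in> {0..1}"
  shows "A * sqrt \<epsilon> \<le> q \<epsilon> x" "0 < q \<epsilon> x" "q \<epsilon> x \<le> M + A"
proof -
  show "A * sqrt \<epsilon> \<le> q \<epsilon> x"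
    using p_nonneg[OF assms(3)] by (simp add: q_def)
  then show "0 < q \<epsilon> x"
    using A_ge_1 assms by (smt (verit) mult_pos_pos real_sqrt_gt_zero)
  show "q \<epsilon> x \<le> M + A"
    using D_bounds(1)[OF assms(3)] A_ge_1 assms by (auto simp: q_def intro!: add_mono mult_left_le)
qed

lemma barrier_derivatives:
  assumes "0 < \<epsilon>" "\<epsilon> \<le> 1" "x \<in> {0..1}"
  shows "(barrier k \<epsilon> has_real_derivative barrier1 k \<epsilon> x) (at x within {0..1})"
    and "(barrier1 k \<epsilon> has_real_derivative barrier2 k \<epsilon> x) (at x within {0..1})"
proof -
  have dp: "(p has_real_derivative D 1 p x) (at x within {0..1})"
    "(D 1 p has_real_derivative D 2 p x) (at x within {0..1})"
    using smooth_within_has_derivative[OF smooth(1) assms(3), of 0]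
      smooth_within_has_derivative[OF smooth(1) assms(3), of 1]
    by (simp_all add: numeral_2_eq_2)
  have dq: "(q \<epsilon> has_real_derivative D 1 p x) (at x within {0..1})"
    unfolding q_def using dp by (auto intro!: derivative_eq_intros)
  have d\<phi>: "(\<phi> \<epsilon> has_real_derivative 2 * c * x / \<epsilon> * \<phi> \<epsilon> x) (at x within {0..1})"
    unfolding \<phi>_def using assms by (auto intro!: derivative_eq_intros simp: field_simps)
  have q: "q \<epsilon> x \<noteq> 0"
    using q_bounds[OF assms] by simp
  show "(barrier k \<epsilon> has_real_derivative barrier1 k \<epsilon> x) (at x within {0..1})"
    unfolding barrier_def barrier1_def
    by (intro DERIV_add DERIV_cdivide has_real_derivative_inverse_power dq d\<phi> q)
  have "((\<lambda>x. - (real k * D 1 p x) * (1 / q \<epsilon> x ^ Suc k) + (2 * c / \<epsilon>) * x * \<phi> \<epsilon> x / \<epsilon> ^ k)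
      has_real_derivative
        (- (real k * D 2 p x) * (1 / q \<epsilon> x ^ Suc k)
         + (- (real (Suc k) * D 1 p x) / q \<epsilon> x ^ Suc (Suc k)) * - (real k * D 1 p x))
        + ((2 * c / \<epsilon> * 1) * \<phi> \<epsilon> x + (2 * c * x / \<epsilon> * \<phi> \<epsilon> x) * (2 * c / \<epsilon> * x)) / \<epsilon> ^ k)
      (at x within {0..1})"
    by (intro DERIV_add DERIV_cdivide DERIV_mult DERIV_minus DERIV_cmult DERIV_ident
        has_real_derivative_inverse_power dq dp d\<phi> q)
  moreover have "(- (real k * D 2 p x) * (1 / q \<epsilon> x ^ Suc k)
         + (- (real (Suc k) * D 1 p x) / q \<epsilon> x ^ Suc (Suc k)) * - (real k * D 1 p x))
        + ((2 * c / \<epsilon> * 1) * \<phi> \<epsilon> x + (2 * c * x / \<epsilon> * \<phi> \<epsilon> x) * (2 * c / \<epsilon> * x)) / \<epsilon> ^ k = barrier2 k \<epsilon> x"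
    by (simp add: barrier2_def power2_eq_square add_divide_distrib algebra_simps)
  finally   show "(barrier1 k \<epsilon> has_real_derivative barrier2 k \<epsilon> x) (at x within {0..1})"
    unfolding barrier1_def by simp
qed

text \<open>
  Taking powers of \<open>p + A sqrt \<epsilon>\<close> rather than of \<open>x + A sqrt \<epsilon>\<close> makes the term \<open>k p'\<close> of the
  differentiated equation absorb the transport term on all of \<open>[0,1]\<close>; the second summand accounts
  for the boundary layer at \<open>x = 1\<close>.
\<close>
lemma barrier_supersolution:
  assumes \<epsilon>: "0 < \<epsilon>" "\<epsilon> \<le> 1" and x: "x \<in> {0..1}" and "k \<le> N"
  shows "\<epsilon> * barrier2 k \<epsilon> x
    \<le> p x * barrier1 k \<epsilon> x + (b x + k * D 1 p x - b\<^sub>0 / 2) * barrier k \<epsilon> x"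
proof -
  define s where "s = q \<epsilon> x"
  have s: "A * sqrt \<epsilon> \<le> s" "0 < s"
    using q_bounds[OF \<epsilon> x] by (auto simp: s_def)
  have dp: "0 \<le> D 1 p x" "\<bar>D 1 p x\<bar> \<le> M" "\<bar>D 2 p x\<bar> \<le> M"
    using dp_ge[OF x] \<alpha>_pos M_bound(1)[of 1 x] M_bound(1)[of 2 x] x by auto
  have A: "0 < A" using A_ge_1 by simp
  have "\<epsilon> * A \<le> s"
  proof -
    have "\<epsilon> \<le> sqrt \<epsilon>"
      using \<epsilon> by (simp add: real_le_rsqrt power2_eq_square mult_left_le)
    then have "A * \<epsilon> \<le> A * sqrt \<epsilon>"
      using A by (intro mult_left_mono) auto
    with s(1) show ?thesis by (simp add: mult.commute)
  qed
  have "\<epsilon> * A \<le> s\<^sup>2"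
  proof -
    have "\<epsilon> * A \<le> \<epsilon> * A\<^sup>2"
      using A A_ge_1 \<epsilon> by (intro mult_left_mono) (auto simp: power2_eq_square)
    also have "\<dots> = (A * sqrt \<epsilon>)\<^sup>2"
      using \<epsilon> by (simp add: power_mult_distrib)
    also have "\<dots> \<le> s\<^sup>2"
      using s A \<epsilon> by (intro power_mono) auto
    finally show ?thesis .
  qed
  \<comment> \<open>Diffusion of the algebraic summand: relative to \<open>1 / s ^ k\<close> it
    carries the factors \<open>\<epsilon> / s\<close> and \<open>\<epsilon> / s\<^sup>2\<close>,
    both at most \<open>1 / A\<close>.\<close>
  have 1: "\<epsilon> * (- (real k * D 2 p x) / s ^ Suc k + real k * real (Suc k) * (D 1 p x)\<^sup>2 / s ^ Suc (Suc k))
      \<le> b\<^sub>0 / 2 * (1 / s ^ k)"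
  proof -
    have "\<epsilon> * (- (real k * D 2 p x) / s ^ Suc k + real k * real (Suc k) * (D 1 p x)\<^sup>2 / s ^ Suc (Suc k))
      = (real k * - D 2 p x * (\<epsilon> / s) + real k * real (Suc k) * (D 1 p x)\<^sup>2 * (\<epsilon> / s\<^sup>2)) / s ^ k"
      using s by (simp add: field_simps power2_eq_square)
    also have "\<dots> \<le> (real k * \<bar>D 2 p x\<bar> * (\<epsilon> / s) + real k * real (Suc k) * (D 1 p x)\<^sup>2 * (\<epsilon> / s\<^sup>2)) / s ^ k"
      using s \<epsilon> by (intro divide_right_mono add_right_mono mult_right_mono mult_left_mono) auto
    also have "\<dots> \<le> (real N * M * (1 / A) + real N * real (Suc N) * M\<^sup>2 * (1 / A)) / s ^ k"
    proof (intro divide_right_mono add_mono mult_mono)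
      show "\<epsilon> / s \<le> 1 / A" "\<epsilon> / s\<^sup>2 \<le> 1 / A"
        using \<open>\<epsilon> * A \<le> s\<close> \<open>\<epsilon> * A \<le> s\<^sup>2\<close> s A by (simp_all add: field_simps)
      have "\<bar>D 1 p x\<bar>\<^sup>2 \<le> M\<^sup>2"
        using dp by (intro power_mono) auto
      then show "(D 1 p x)\<^sup>2 \<le> M\<^sup>2" by simp
    qed (use dp \<open>k \<le> N\<close> s \<epsilon> M_ge_1 in auto)
    also have "\<dots> = (real N * M + real N * real (Suc N) * M\<^sup>2) / A / s ^ k"
      by (simp add: add_divide_distrib)
    also have "\<dots> \<le> b\<^sub>0 / 2 / s ^ k"
    proof (rule divide_right_mono)
      have "real N * M + real N * real (Suc N) * M\<^sup>2 \<le> b\<^sub>0 / 2 * A"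
        using b\<^sub>0_pos by (simp add: A_def field_simps)
      then show "(real N * M + real N * real (Suc N) * M\<^sup>2) / A \<le> b\<^sub>0 / 2"
        using A by (simp add: field_simps)
    qed (use s in auto)
    finally show ?thesis by simp
  qed
  \<comment> \<open>Near cancellation of transport against \<open>k p'\<close>: the shift in
    \<open>s\<close> leaves the factor \<open>p x / s \<le> 1\<close>, with the favourable sign
    because p' >= 0.\<close>
  have 2: "- (k * D 1 p x) * (1 / s ^ k) \<le> p x * (- (real k * D 1 p x) / s ^ Suc k)"
  proof -
    have "k * D 1 p x * (p x / s) / s ^ k \<le> k * D 1 p x * 1 / s ^ k"
      using s dp p_nonneg[OF x] A \<epsilon>
      by (intro divide_right_mono mult_left_mono) (auto simp: s_def q_def)
    then show ?thesis
      using s by (simp add: field_simps)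
  qed
  have 3: "\<epsilon> * (2 * c / \<epsilon> + (2 * c * x / \<epsilon>)\<^sup>2) \<le> p x * (2 * c * x / \<epsilon>) + b\<^sub>0 / 2"
  proof -
    have "2 * c * x * (2 * c * x / \<epsilon>) \<le> p x * (2 * c * x / \<epsilon>)"
    proof (rule mult_right_mono)
      have "2 * c * x \<le> \<alpha> * x"
        using c_le x by (intro mult_right_mono) auto
      then show "2 * c * x \<le> p x"
        using p_ge[OF x] by simp
    qed (use c_pos x \<epsilon> in auto)
    moreover have "\<epsilon> * (2 * c / \<epsilon> + (2 * c * x / \<epsilon>)\<^sup>2) = 2 * c + 2 * c * x * (2 * c * x / \<epsilon>)"
      using \<epsilon> by (simp add: field_simps power2_eq_square)
    ultimately show ?thesis
      using c_le by simp
  qed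
  have E: "0 \<le> \<phi> \<epsilon> x / \<epsilon> ^ k" and S: "0 \<le> 1 / s ^ k"
    using \<epsilon> s by (auto simp: \<phi>_def)
  have "\<epsilon> * barrier2 k \<epsilon> x \<le> b\<^sub>0 / 2 * (1 / s ^ k) + (p x * (2 * c * x / \<epsilon>) + b\<^sub>0 / 2) * (\<phi> \<epsilon> x / \<epsilon> ^ k)"
  proof -
    have "\<epsilon> * (2 * c / \<epsilon> + (2 * c * x / \<epsilon>)\<^sup>2) * (\<phi> \<epsilon> x / \<epsilon> ^ k)
        \<le> (p x * (2 * c * x / \<epsilon>) + b\<^sub>0 / 2) * (\<phi> \<epsilon> x / \<epsilon> ^ k)"
      by (rule mult_right_mono[OF 3 E])
    moreover have "\<epsilon> * barrier2 k \<epsilon> x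
      = \<epsilon> * (- (real k * D 2 p x) / s ^ Suc k + real k * real (Suc k) * (D 1 p x)\<^sup>2 / s ^ Suc (Suc k))
        + \<epsilon> * (2 * c / \<epsilon> + (2 * c * x / \<epsilon>)\<^sup>2) * (\<phi> \<epsilon> x / \<epsilon> ^ k)"
      unfolding barrier2_def s_def[symmetric] by (subst distrib_left) (simp only: times_divide_eq_right mult.assoc)
    ultimately show ?thesis
      using 1 by linarith
  qed
  also have "\<dots> \<le> p x * barrier1 k \<epsilon> x + (b\<^sub>0 / 2 + k * D 1 p x) * (1 / s ^ k)
      + b\<^sub>0 / 2 * (\<phi> \<epsilon> x / \<epsilon> ^ k)"
    using 2 by (simp add: barrier1_def algebra_simps flip: s_def)
  also have "\<dots> \<le> p x * barrier1 k \<epsilon> x + (b x + k * D 1 p x - b\<^sub>0 / 2) * (1 / s ^ k)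
      + (b x + k * D 1 p x - b\<^sub>0 / 2) * (\<phi> \<epsilon> x / \<epsilon> ^ k)"
  proof (intro add_mono[OF add_left_mono] mult_right_mono E S)
    have "0 \<le> k * D 1 p x" using dp by simp
    then show "b\<^sub>0 / 2 + k * D 1 p x \<le> b x + k * D 1 p x - b\<^sub>0 / 2"
      "b\<^sub>0 / 2 \<le> b x + k * D 1 p x - b\<^sub>0 / 2"
      using b_ge[OF x] by linarith+
  qed
  also have "\<dots> = p x * barrier1 k \<epsilon> x + (b x + k * D 1 p x - b\<^sub>0 / 2) * barrier k \<epsilon> x"
    by (simp add: barrier_def algebra_simps flip: s_def)
  finally show ?thesis .
qed

text \<open>Since \<open>q\<close> is bounded above and \<open>\<epsilon> \<le> 1\<close>, raising
  the order costs only a constant. Lower order terms and the constant 1 in the right-hand side are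
  thereby measured against the barrier of order k.\<close>

lemma barrier_mono:
  assumes "0 < \<epsilon>" "\<epsilon> \<le> 1" "x \<in> {0..1}" "i \<le> k"
  shows "barrier i \<epsilon> x \<le> (M + A) ^ k * barrier k \<epsilon> x" and "1 \<le> (M + A) ^ k * barrier k \<epsilon> x"
    and "0 \<le> barrier k \<epsilon> x"
proof -
  note q = q_bounds[OF assms(1-3)]
  have Q: "1 \<le> M + A"
    using M_ge_1 A_ge_1 by simp
  have *: "1 / q \<epsilon> x ^ i \<le> (M + A) ^ k * (1 / q \<epsilon> x ^ k)" if "i \<le> k" for i
  proof -
    have "q \<epsilon> x ^ k = q \<epsilon> x ^ (k - i) * q \<epsilon> x ^ i"
      using that by (simp flip: power_add)
    moreover have "q \<epsilon> x ^ (k - i) \<le> (M + A) ^ (k - i)"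
      using q by (intro power_mono) auto
    moreover have "(M + A) ^ (k - i) \<le> (M + A) ^ k"
      using Q by (intro power_increasing) auto
    ultimately show ?thesis
      using q(2) by (simp add: field_simps)
  qed
  have \<phi>: "0 \<le> \<phi> \<epsilon> x"
    by (simp add: \<phi>_def)
  have "\<phi> \<epsilon> x / \<epsilon> ^ i \<le> \<phi> \<epsilon> x / \<epsilon> ^ k"
    using assms \<phi> by (intro divide_left_mono power_decreasing) auto
  also have "\<dots> \<le> (M + A) ^ k * (\<phi> \<epsilon> x / \<epsilon> ^ k)"
    using mult_right_mono[of 1 "(M + A) ^ k" "\<phi> \<epsilon> x / \<epsilon> ^ k"] Q \<phi> assms by simp
  finally show "barrier i \<epsilon> x \<le> (M + A) ^ k * barrier k \<epsilon> x"
    using *[OF \<open>i \<le> k\<close>] by (simp add: barrier_def distrib_left)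
  have "0 \<le> (M + A) ^ k * (\<phi> \<epsilon> x / \<epsilon> ^ k)"
    using Q \<phi> assms by auto
  then show "1 \<le> (M + A) ^ k * barrier k \<epsilon> x"
    using *[of 0] by (simp add: barrier_def distrib_left)
  show "0 \<le> barrier k \<epsilon> x"
    using q(2) \<phi> assms by (simp add: barrier_def)
qed

section \<open>Comparison with the barrier, by induction on the order of the derivative\<close>

lemma barrier_bound_step:
  assumes "k \<le> N" and "0 \<le> K'" "0 \<le> K\<^sub>b"
    and IH: "\<And>\<epsilon> u i x. solution \<epsilon> u \<Longrightarrow> i < k \<Longrightarrow> x \<in> {0..1} \<Longrightarrow> \<bar>D i u x\<bar> \<le> K' * barrier i \<epsilon> x"
    and bdry: "\<And>\<epsilon> u. solution \<epsilon> u \<Longrightarrow> \<bar>D k u 0\<bar> \<le> K\<^sub>b / sqrt \<epsilon> ^ k \<and> \<bar>D k u 1\<bar> \<le> K\<^sub>b / \<epsilon> ^ k"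
  shows "\<exists>K\<ge>0. \<forall>\<epsilon> u x. solution \<epsilon> u \<and> x \<in> {0..1} \<longrightarrow> \<bar>D k u x\<bar> \<le> K * barrier k \<epsilon> x"
proof -
  define L where "L = M * (2 ^ Suc k * K' + 1) * (M + A) ^ k"
  \<comment> \<open>The first summand covers the end points:
    \<open>q \<epsilon> 0 = A * sqrt \<epsilon>\<close> accounts for \<open>A ^ k\<close>, and
    \<open>\<phi> \<epsilon> 1 = 1\<close>. The second covers the right-hand side, bounded by
    \<open>L * barrier k \<epsilon> y\<close>, through the reserve \<open>b\<^sub>0 / 2\<close> of
    the supersolution.\<close>
  define K where "K = K\<^sub>b * A ^ k + 2 / b\<^sub>0 * L"
  have L: "0 \<le> L"
    using M_ge_1 A_ge_1 \<open>0 \<le> K'\<close> by (simp add: L_def)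
  have K: "0 \<le> K\<^sub>b * A ^ k" "0 \<le> 2 / b\<^sub>0 * L" "0 \<le> K"
    using A_ge_1 \<open>0 \<le> K\<^sub>b\<close> L b\<^sub>0_pos by (auto simp: K_def)
  have "\<bar>D k u x\<bar> \<le> K * barrier k \<epsilon> x" if u: "solution \<epsilon> u" and x: "x \<in> {0..1}" for \<epsilon> u x
  proof -
    have \<epsilon>: "0 < \<epsilon>" "\<epsilon> \<le> 1" using u by (auto simp: solution_def)
    have inner: "at x within {0..1} = at x" if "x \<in> {0<..<1}" for x :: real
      using that by (intro at_within_Icc_at) auto
    have "s * D k u x \<le> K * barrier k \<epsilon> x" if s: "s = 1 \<or> s = - 1" for s
    proof (rule maximum_principle[where l = 0 and r = 1 and w = "\<lambda>x. s * D k u x"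
          and B = "\<lambda>x. K * barrier k \<epsilon> x"])
      show "continuous_on {0..1} (\<lambda>x. s * D k u x)"
        using solution_derivative[OF u] by (intro continuous_intros DERIV_continuous_on)
      show "continuous_on {0..1} (\<lambda>x. K * barrier k \<epsilon> x)"
        using barrier_derivatives(1)[OF \<epsilon>] by (intro continuous_intros DERIV_continuous_on)
      have "s * D k u 0 \<le> \<bar>D k u 0\<bar>" using s by auto
      also have "\<dots> \<le> K\<^sub>b / sqrt \<epsilon> ^ k" using bdry[OF u] by simp
      also have "\<dots> = K\<^sub>b * A ^ k * (1 / q \<epsilon> 0 ^ k)"
        using A_ge_1 \<epsilon> by (simp add: q_def p_0 power_mult_distrib)
      also have "\<dots> \<le> K * barrier k \<epsilon> 0"
        using K \<epsilon> q_bounds(2)[OF \<epsilon>, of 0]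
        by (intro mult_mono) (auto simp: K_def barrier_def \<phi>_def)
      finally show "s * D k u 0 \<le> K * barrier k \<epsilon> 0" .
      have "s * D k u 1 \<le> \<bar>D k u 1\<bar>" using s by auto
      also have "\<dots> \<le> K\<^sub>b / \<epsilon> ^ k" using bdry[OF u] by simp
      also have "\<dots> = K\<^sub>b * 1 * (1 / \<epsilon> ^ k)" by simp
      also have "\<dots> \<le> K\<^sub>b * A ^ k * (1 / \<epsilon> ^ k)"
        using A_ge_1 \<open>0 \<le> K\<^sub>b\<close> \<epsilon> by (intro mult_left_mono mult_right_mono) auto
      also have "\<dots> \<le> K * barrier k \<epsilon> 1"
        using K \<epsilon> q_bounds(2)[OF \<epsilon>, of 1]
        by (intro mult_mono) (auto simp: K_def barrier_def \<phi>_def)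
      finally show "s * D k u 1 \<le> K * barrier k \<epsilon> 1" .
      fix y :: real assume y: "y \<in> {0<..<1}"
      then have y1: "y \<in> {0..1}" by auto
      note du = solution_derivative[OF u y1, unfolded inner[OF y]]
      note dB = barrier_derivatives[OF \<epsilon> y1, unfolded inner[OF y]]
      show "((\<lambda>x. s * D k u x) has_real_derivative s * D (Suc k) u y) (at y)"
        "((\<lambda>x. s * D (Suc k) u x) has_real_derivative s * D (Suc (Suc k)) u y) (at y)"
        by (intro DERIV_cmult du)+
      show "((\<lambda>x. K * barrier k \<epsilon> x) has_real_derivative K * barrier1 k \<epsilon> y) (at y)"
        "((\<lambda>x. K * barrier1 k \<epsilon> x) has_real_derivative K * barrier2 k \<epsilon> y) (at y)"
        by (intro DERIV_cmult dB)+
      \<comment> \<open>By \<open>crit\<close> the transport terms coincide and the reserve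
        \<open>b\<^sub>0 / 2\<close> absorbs \<open>F\<close>; strictness comes from multiplying
        \<open>above\<close> by the positive coefficient \<open>a\<close>.\<close>
      assume above: "K * barrier k \<epsilon> y < s * D k u y"
        and crit: "s * D (Suc k) u y = K * barrier1 k \<epsilon> y"
      define a where "a = b y + k * D 1 p y"
      have a: "0 < a"
        using b_ge[OF y1] b\<^sub>0_pos dp_ge[OF y1] \<alpha>_pos by (simp add: a_def add_pos_nonneg)
      define F where "F = \<epsilon> * D (Suc (Suc k)) u y - (p y * D (Suc k) u y + a * D k u y)"
      have Q: "barrier i \<epsilon> y \<le> (M + A) ^ k * barrier k \<epsilon> y" "1 \<le> (M + A) ^ k * barrier k \<epsilon> y"
        "0 \<le> barrier k \<epsilon> y" if "i \<le> k" for i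
        using barrier_mono[OF \<epsilon> y1 that] by auto
      have "\<bar>F\<bar> \<le> M * (2 ^ Suc k * (K' * ((M + A) ^ k * barrier k \<epsilon> y)) + 1)"
        unfolding F_def a_def
      proof (rule differentiated_equation[OF u y1 \<open>k \<le> N\<close>])
        fix i assume i: "i < k"
        have "\<bar>D i u y\<bar> \<le> K' * barrier i \<epsilon> y"
          by (rule IH[OF u i y1])
        also have "\<dots> \<le> K' * ((M + A) ^ k * barrier k \<epsilon> y)"
          using i \<open>0 \<le> K'\<close> by (intro mult_left_mono Q) auto
        finally show "\<bar>D i u y\<bar> \<le> K' * ((M + A) ^ k * barrier k \<epsilon> y)" .
      next
        show "0 \<le> K' * ((M + A) ^ k * barrier k \<epsilon> y)"
          using \<open>0 \<le> K'\<close> Q(2)[of k] by (intro mult_nonneg_nonneg[OF \<open>0 \<le> K'\<close>]) linarith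
      qed
      also have "\<dots> \<le> M * (2 ^ Suc k * (K' * ((M + A) ^ k * barrier k \<epsilon> y))
          + (M + A) ^ k * barrier k \<epsilon> y)"
        using M_ge_1 Q(2)[of k] by (intro mult_left_mono add_left_mono) auto
      also have "\<dots> = L * barrier k \<epsilon> y"
        by (simp add: L_def algebra_simps)
      also have "\<dots> = b\<^sub>0 / 2 * ((2 / b\<^sub>0 * L) * barrier k \<epsilon> y)"
        using b\<^sub>0_pos by simp
      also have "\<dots> \<le> b\<^sub>0 / 2 * (K * barrier k \<epsilon> y)"
        using K b\<^sub>0_pos Q(3)[of k] by (intro mult_left_mono mult_right_mono) (auto simp: K_def)
      finally have "- (s * F) \<le> b\<^sub>0 / 2 * (K * barrier k \<epsilon> y)"
        using s by auto
      moreover have "a * (K * barrier k \<epsilon> y) < a * (s * D k u y)"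
        using a above by simp
      moreover have "K * (\<epsilon> * barrier2 k \<epsilon> y) \<le> K * (p y * barrier1 k \<epsilon> y + (a - b\<^sub>0 / 2) * barrier k \<epsilon> y)"
        using barrier_supersolution[OF \<epsilon> y1 \<open>k \<le> N\<close>] K(3)
        by (intro mult_left_mono) (auto simp: a_def)
      moreover have "K * (p y * barrier1 k \<epsilon> y + (a - b\<^sub>0 / 2) * barrier k \<epsilon> y)
          = p y * (s * D (Suc k) u y) + a * (K * barrier k \<epsilon> y) - b\<^sub>0 / 2 * (K * barrier k \<epsilon> y)"
        unfolding crit by (simp add: algebra_simps)
      moreover have "\<epsilon> * (s * D (Suc (Suc k)) u y) = p y * (s * D (Suc k) u y) + a * (s * D k u y) + s * F"
        by (simp add: F_def algebra_simps)
      ultimately have "\<epsilon> * (K * barrier2 k \<epsilon> y) < \<epsilon> * (s * D (Suc (Suc k)) u y)"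
        by (simp add: mult.left_commute[of \<epsilon> K])
      then show "K * barrier2 k \<epsilon> y < s * D (Suc (Suc k)) u y"
        using \<epsilon> by simp
    qed (use x in auto)
    from this[of 1] this[of "- 1"] show ?thesis by (simp add: abs_le_iff)
  qed
  with K show ?thesis by blast
qed

text \<open>The comparison step of order 0, where no lower derivatives occur and the boundary values
  are the data themselves; the barrier of order 0 is \<open>1 + \<phi> \<epsilon> x \<le> 2\<close>.
  This supplies the bound \<open>m\<close> on which the boundary estimates rest.\<close>

lemma solution_bound: "\<exists>m\<ge>0. \<forall>\<epsilon> u x. solution \<epsilon> u \<and> x \<in> {0..1} \<longrightarrow> \<bar>u x\<bar> \<le> m"
proof -
  have "\<exists>K\<ge>0. \<forall>\<epsilon> u x. solution \<epsilon> u \<and> x \<in> {0..1} \<longrightarrow> \<bar>D 0 u x\<bar> \<le> K * barrier 0 \<epsilon> x"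
    using M_ge_1 data_bound
    by (intro barrier_bound_step[of 0 0 M]) (auto simp: solution_def bvp_solution_def)
  then obtain K where K: "0 \<le> K" "\<And>\<epsilon> u x. solution \<epsilon> u \<Longrightarrow> x \<in> {0..1} \<Longrightarrow> \<bar>u x\<bar> \<le> K * barrier 0 \<epsilon> x"
    by auto
  have "\<bar>u x\<bar> \<le> K * 2" if u: "solution \<epsilon> u" and x: "x \<in> {0..1}" for \<epsilon> u x
  proof -
    have "\<phi> \<epsilon> x \<le> 1"
      using u x c_pos by (auto simp: \<phi>_def solution_def abs_square_le_1)
    then have "K * barrier 0 \<epsilon> x \<le> K * 2"
      using K(1) by (intro mult_left_mono) (auto simp: barrier_def)
    with K(2)[OF u x] show ?thesis by simp
  qed
  with K(1) show ?thesis
    by (intro exI[of _ "K * 2"]) auto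
qed

text \<open>Stated for all orders below \<open>n\<close> with one constant, because the step for
  order k consumes every lower order at once.\<close>

lemma derivative_bound_barrier:
  assumes "n \<le> Suc N"
  shows "\<exists>K\<ge>0. \<forall>\<epsilon> u i x. solution \<epsilon> u \<and> i < n \<and> x \<in> {0..1} \<longrightarrow> \<bar>D i u x\<bar> \<le> K * barrier i \<epsilon> x"
  using assms
proof (induction n)
  case (Suc k)
  then obtain K' where K': "0 \<le> K'"
    "\<And>\<epsilon> u i x. solution \<epsilon> u \<Longrightarrow> i < k \<Longrightarrow> x \<in> {0..1} \<Longrightarrow> \<bar>D i u x\<bar> \<le> K' * barrier i \<epsilon> x"
    by (metis Suc_leD)
  obtain m where m: "0 \<le> m" "\<And>\<epsilon> u x. solution \<epsilon> u \<Longrightarrow> x \<in> {0..1} \<Longrightarrow> \<bar>u x\<bar> \<le> m"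
    using solution_bound by blast
  have "k \<le> N" using Suc.prems by simp
  obtain K\<^sub>b where K\<^sub>b: "0 \<le> K\<^sub>b"
    "\<And>\<epsilon> u. solution \<epsilon> u \<Longrightarrow> \<bar>D k u 0\<bar> \<le> K\<^sub>b / sqrt \<epsilon> ^ k \<and> \<bar>D k u 1\<bar> \<le> K\<^sub>b / \<epsilon> ^ k"
    using boundary_bound[OF \<open>k \<le> N\<close> m(1)] m(2) by blast
  obtain K where K: "0 \<le> K"
    "\<And>\<epsilon> u x. solution \<epsilon> u \<Longrightarrow> x \<in> {0..1} \<Longrightarrow> \<bar>D k u x\<bar> \<le> K * barrier k \<epsilon> x"
    using barrier_bound_step[OF \<open>k \<le> N\<close> K'(1) K\<^sub>b(1) K'(2) K\<^sub>b(2)] by auto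
  have "\<bar>D i u x\<bar> \<le> max K K' * barrier i \<epsilon> x"
    if u: "solution \<epsilon> u" and i: "i < Suc k" and x: "x \<in> {0..1}" for \<epsilon> u i x
  proof -
    have "0 \<le> barrier i \<epsilon> x"
      using barrier_mono(3)[of \<epsilon> x i i] u x by (auto simp: solution_def)
    then have "K * barrier i \<epsilon> x \<le> max K K' * barrier i \<epsilon> x"
      "K' * barrier i \<epsilon> x \<le> max K K' * barrier i \<epsilon> x"
      by (auto intro!: mult_right_mono)
    with K(2)[OF u x] K'(2)[OF u _ x, of i] i show ?thesis
      by (cases "i = k") (auto intro: order_trans)
  qed
  with K(1) show ?case
    by (intro exI[of _ "max K K'"]) auto
qed auto

end

section \<open>Passage to [0,1/2] and the final estimate\<close>

lemma power_le_fact_mult_exp: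
  fixes y :: real
  assumes "0 \<le> y"
  shows "y ^ k \<le> fact k * exp y"
proof -
  have "summable (\<lambda>n. y ^ n /\<^sub>R fact n)"
    using exp_converges sums_summable by blast
  then have "(\<Sum>n\<in>{k}. y ^ n /\<^sub>R fact n) \<le> (\<Sum>n. y ^ n /\<^sub>R fact n)"
    using assms by (intro sum_le_suminf) auto
  then show ?thesis
    by (simp add: exp_def field_simps)
qed

context turning_point_problem
begin

text \<open>For x <= 1/2 one has 1 - x^2 >= 3/4, so \<open>\<phi> \<epsilon> x\<close> is at most
  exp(-y) with y = 3c/(4\<epsilon>); the bound y^k <= k! exp(y) then cancels the factor
  \<epsilon>^-k.\<close>

lemma barrier_le:
  assumes \<epsilon>: "0 < \<epsilon>" "\<epsilon> \<le> 1" and x: "0 \<le> x" "x \<le> 1 / 2"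
  shows "barrier k \<epsilon> x \<le> 1 / q \<epsilon> x ^ k + fact k / (3 * c / 4) ^ k"
proof -
  define y where "y = 3 * c / 4 / \<epsilon>"
  have y: "0 < y" using c_pos \<epsilon> by (simp add: y_def)
  have "x\<^sup>2 \<le> (1 / 2)\<^sup>2"
    using x by (intro power_mono) auto
  then have "c * (3 / 4) \<le> c * (1 - x\<^sup>2)"
    using c_pos by (intro mult_left_mono) (auto simp: power2_eq_square)
  then have "y \<le> c * (1 - x\<^sup>2) / \<epsilon>"
    using \<epsilon> by (simp add: y_def field_simps)
  then have "\<phi> \<epsilon> x \<le> 1 / exp y"
    by (simp add: \<phi>_def flip: exp_minus inverse_eq_divide)
  also have "\<dots> \<le> fact k / y ^ k"
    using power_le_fact_mult_exp[of y k] y by (simp add: field_simps)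
  also have "\<dots> = fact k / (3 * c / 4) ^ k * \<epsilon> ^ k"
    by (simp add: y_def power_divide)
  finally show ?thesis
    using \<epsilon> by (simp add: barrier_def field_simps)
qed

lemma derivative_bound:
  assumes "k \<le> N" and C0: "0 < C0"
  shows "\<exists>C. \<forall>\<epsilon> u \<rho> x. solution \<epsilon> u \<and> \<rho> = C0 * sqrt \<epsilon> \<and> 0 \<le> x \<and> x \<le> 1 / 2 \<longrightarrow>
    (x \<le> \<rho> \<longrightarrow> \<bar>D k u x\<bar> \<le> C * (1 + \<rho> powi (- int k))) \<and>
    (\<rho> \<le> x \<longrightarrow> \<bar>D k u x\<bar> \<le> C * (1 + x powi (- int k)))"
proof -
  obtain K where K: "0 \<le> K"
    "\<And>\<epsilon> u x. solution \<epsilon> u \<Longrightarrow> x \<in> {0..1} \<Longrightarrow> \<bar>D k u x\<bar> \<le> K * barrier k \<epsilon> x"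
    using derivative_bound_barrier[of "Suc k"] \<open>k \<le> N\<close> by auto
  define L where "L = fact k / (3 * c / 4) ^ k"
  define C where "C = K * (L + C0 ^ k + (1 / \<alpha>) ^ k)"
  have L: "0 \<le> L"
    using c_pos by (simp add: L_def)
  \<comment> \<open>Both cases of the claim follow from \<open>r \<le> a * q \<epsilon> x\<close>:
    take \<open>r = \<rho>\<close>, \<open>a = C0\<close>, since \<open>q\<close> is at least
    \<open>sqrt \<epsilon>\<close>, or \<open>r = x\<close>, \<open>a = 1 / \<alpha>\<close>, since
    \<open>q\<close> is at least \<open>\<alpha> * x\<close>.\<close>
  have main: "\<bar>D k u x\<bar> \<le> C * (1 + r powi (- int k))"
    if u: "solution \<epsilon> u" and x: "0 \<le> x" "x \<le> 1 / 2" and r: "0 < r" "r \<le> a * q \<epsilon> x"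
      and a: "a = C0 \<or> a = 1 / \<alpha>" for \<epsilon> u x r a
  proof -
    have \<epsilon>: "0 < \<epsilon>" "\<epsilon> \<le> 1" using u by (auto simp: solution_def)
    have x1: "x \<in> {0..1}" using x by auto
    have q: "0 < q \<epsilon> x" by (rule q_bounds[OF \<epsilon> x1])
    have a_pos: "0 < a" using a C0 \<alpha>_pos by auto
    have "r ^ k \<le> (a * q \<epsilon> x) ^ k"
      using r by (intro power_mono) auto
    then have "1 / q \<epsilon> x ^ k \<le> a ^ k * (1 / r ^ k)"
      using q r by (simp add: field_simps power_mult_distrib)
    then have "barrier k \<epsilon> x \<le> L + a ^ k * (1 / r ^ k)"
      using barrier_le[OF \<epsilon> x, of k] by (simp add: L_def)
    also have "\<dots> \<le> (L + a ^ k) * (1 + 1 / r ^ k)"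
    proof -
      have "0 \<le> L * (1 / r ^ k)" "0 \<le> a ^ k"
        using L a_pos r by auto
      then show ?thesis
        unfolding distrib_left distrib_right mult_1_right by linarith
    qed
    also have "\<dots> \<le> (L + C0 ^ k + (1 / \<alpha>) ^ k) * (1 + 1 / r ^ k)"
      using a C0 \<alpha>_pos r by (intro mult_right_mono) auto
    finally have "K * barrier k \<epsilon> x \<le> K * ((L + C0 ^ k + (1 / \<alpha>) ^ k) * (1 + 1 / r ^ k))"
      using K(1) by (intro mult_left_mono)
    with K(2)[OF u x1] show ?thesis
      by (simp add: C_def power_int_minus inverse_eq_divide mult.assoc)
  qed
  show ?thesis
  proof (intro exI[of _ C] allI impI conjI; elim conjE)
    fix \<epsilon> \<rho> x :: real and u
    assume u: "solution \<epsilon> u" and \<rho>: "\<rho> = C0 * sqrt \<epsilon>" and x: "0 \<le> x" "x \<le> 1 / 2"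
    have \<epsilon>: "0 < \<epsilon>" "\<epsilon> \<le> 1" using u by (auto simp: solution_def)
    have x1: "x \<in> {0..1}" using x by auto
    have \<rho>_pos: "0 < \<rho>" using C0 \<epsilon> by (simp add: \<rho>)
    have s: "1 * sqrt \<epsilon> \<le> A * sqrt \<epsilon>"
      using A_ge_1 \<epsilon> by (intro mult_right_mono) auto
    show "\<bar>D k u x\<bar> \<le> C * (1 + \<rho> powi (- int k))"
      using s q_bounds(1)[OF \<epsilon> x1] C0
      by (intro main[OF u x \<rho>_pos, of C0]) (auto simp: \<rho>)
    assume "\<rho> \<le> x"
    have "0 \<le> A * sqrt \<epsilon>" using s \<epsilon> by (auto intro: order_trans[of 0 "sqrt \<epsilon>"])
    then have "\<alpha> * x \<le> q \<epsilon> x"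
      using p_ge[OF x1] by (simp add: q_def)
    then show "\<bar>D k u x\<bar> \<le> C * (1 + x powi (- int k))"
      using \<open>\<rho> \<le> x\<close> \<rho>_pos \<alpha>_pos
      by (intro main[OF u x, of _ "1 / \<alpha>"]) (auto simp: field_simps)
  qed
qed

end

theorem lemma2p2:
  fixes p b f :: "real \<Rightarrow> real" and u_L u_R b\<^sub>0 \<beta> C0 :: real and k :: nat
  assumes "smooth_within {0..1} p" and "smooth_within {0..1} b" and "smooth_within {0..1} f"
    and "p 0 = 0" and "nth_deriv_within {0..1} 1 p 0 > 0"
    and "\<And>x. x \<in> {0..1} \<Longrightarrow>
           \<bar>nth_deriv_within {0..1} 1 p x\<bar> \<ge> 1 / 2 * \<bar>nth_deriv_within {0..1} 1 p 0\<bar>"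
    and "b\<^sub>0 > 0" and "\<And>x. x \<in> {0..1} \<Longrightarrow> b x \<ge> b\<^sub>0"
    and "\<beta> = b 0 / nth_deriv_within {0..1} 1 p 0"
    and "k \<ge> 1"
    and "C0 > 0" and "\<And>j. j \<le> k \<Longrightarrow> weber_asymptotics_from (\<beta> - 1 / 2 + real j) C0"
  shows "\<exists>C. \<forall>\<epsilon> u \<rho>. 0 < \<epsilon> \<and> \<epsilon> \<le> 1 \<and> bvp_solution \<epsilon> p b f u_L u_R u \<and> \<rho> = C0 * sqrt \<epsilon> \<longrightarrow>
           smooth_within {0..1} u \<and>
           (\<forall>x. 0 \<le> x \<and> x \<le> 1 / 2 \<longrightarrow>
              (x \<le> \<rho> \<longrightarrow> \<bar>nth_deriv_within {0..1} k u x\<bar> \<le> C * (1 + \<rho> powi (- int k))) \<and>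
              (\<rho> \<le> x \<longrightarrow> \<bar>nth_deriv_within {0..1} k u x\<bar> \<le> C * (1 + x powi (- int k))))"
proof -
  define \<alpha> where "\<alpha> = nth_deriv_within {0..1} 1 p 0 / 2"
  have \<alpha>: "0 < \<alpha>" using assms(5) by (simp add: \<alpha>_def)
  have abs_ge: "\<alpha> \<le> \<bar>nth_deriv_within {0..1} 1 p x\<bar>" if "x \<in> {0..1}" for x
    using assms(5) assms(6)[OF that] by (simp add: \<alpha>_def)
  \<comment> \<open>The modulus of p' never drops below \<open>\<alpha>\<close>, so p' has no zero;
    being continuous and positive at 0, it cannot change sign.\<close>
  have dp_ge: "\<alpha> \<le> nth_deriv_within {0..1} 1 p x" if x: "x \<in> {0..1}" for x
  proof (rule ccontr)
    assume "\<not> \<alpha> \<le> nth_deriv_within {0..1} 1 p x"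
    then have "nth_deriv_within {0..1} 1 p x \<le> 0"
      using abs_ge[OF x] by linarith
    moreover have "continuous_on {0..x} (nth_deriv_within {0..1} 1 p)"
      using DERIV_continuous_on[OF smooth_within_has_derivative[OF assms(1), of _ 1]] x
      by (auto intro: continuous_on_subset)
    ultimately obtain t where "0 \<le> t" "t \<le> x" "nth_deriv_within {0..1} 1 p t = 0"
      using IVT2'[of "nth_deriv_within {0..1} 1 p" x 0 0] assms(5) x by auto
    then show False
      using abs_ge[of t] \<alpha> x by auto
  qed
  obtain Mp Mb Mf where M:
    "0 \<le> Mp" "\<And>i x. i \<le> k + 2 \<Longrightarrow> x \<in> {0..1} \<Longrightarrow> \<bar>nth_deriv_within {0..1} i p x\<bar> \<le> Mp"
    "0 \<le> Mb" "\<And>i x. i \<le> k + 2 \<Longrightarrow> x \<in> {0..1} \<Longrightarrow> \<bar>nth_deriv_within {0..1} i b x\<bar> \<le> Mb"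
    "0 \<le> Mf" "\<And>i x. i \<le> k + 2 \<Longrightarrow> x \<in> {0..1} \<Longrightarrow> \<bar>nth_deriv_within {0..1} i f x\<bar> \<le> Mf"
    using smooth_within_bounded[OF assms(1), of "k + 2"] smooth_within_bounded[OF assms(2), of "k + 2"]
      smooth_within_bounded[OF assms(3), of "k + 2"] by metis
  interpret turning_point_problem p b f u_L u_R b\<^sub>0 \<alpha> "1 + Mp + Mb + Mf + \<bar>u_L\<bar> + \<bar>u_R\<bar>" k
  proof
    fix i x assume "i \<le> k + 2" "x \<in> {0..1::real}"
    note M' = M(2)[OF this] M(4)[OF this] M(6)[OF this]
    show "\<bar>nth_deriv_within {0..1} i p x\<bar> \<le> 1 + Mp + Mb + Mf + \<bar>u_L\<bar> + \<bar>u_R\<bar>"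
      "\<bar>nth_deriv_within {0..1} i b x\<bar> \<le> 1 + Mp + Mb + Mf + \<bar>u_L\<bar> + \<bar>u_R\<bar>"
      "\<bar>nth_deriv_within {0..1} i f x\<bar> \<le> 1 + Mp + Mb + Mf + \<bar>u_L\<bar> + \<bar>u_R\<bar>"
      using M' M(1,3,5) by linarith+
  qed (use assms(1-4,7,8) \<alpha> dp_ge M(1,3,5) in auto)
  obtain C where "\<forall>\<epsilon> u \<rho> x. solution \<epsilon> u \<and> \<rho> = C0 * sqrt \<epsilon> \<and> 0 \<le> x \<and> x \<le> 1 / 2 \<longrightarrow>
    (x \<le> \<rho> \<longrightarrow> \<bar>D k u x\<bar> \<le> C * (1 + \<rho> powi (- int k))) \<and>
    (\<rho> \<le> x \<longrightarrow> \<bar>D k u x\<bar> \<le> C * (1 + x powi (- int k)))"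
    using derivative_bound[OF order_refl \<open>C0 > 0\<close>] by blast
  then show ?thesis
    using bvp_solution_smooth_within[OF _ _ assms(1-3)] unfolding solution_def by blast
qed

end
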